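(* Let $s,p\in\mathbb{R}$, $\alpha>1/2$ and $\alpha'\ge0$ satisfy $\min\{\alpha,\alpha'\}+s>0$ and $\min\{\alpha,\alpha'\}+(p-1/2)>0$. Suppose that $l^\dagger=\{l_j^\dagger\}\in\mathcal{H}^s$; that the prior variances satisfy $\sigma_j^2=\Theta(j^{-2p})$ as $j\to\infty$; that the training and test covariances satisfy $\vartheta_j^2=\langle\varphi_j,\Lambda\varphi_j\rangle=\Theta(j^{-2\alpha})$ and $\vartheta_j'^2=\langle\varphi_j,\Lambda'\varphi_j\rangle=\Theta(j^{-2\alpha'})$ as $j\to\infty$; and that the training distribution $\nu$ satisfies the moment assumption (M) in the context. Let $$\rho_N=\begin{cases}N^{-\left(1-\frac{\alpha+1/2-\alpha'}{\alpha+p}\right)},&\alpha'<\alpha+1/2,\\ N^{-1}\log N,&\alpha'=\alpha+1/2,\\ N^{-1},&\alpha'>\alpha+1/2.\end{cases}$$ Then $$\mathbb{E}^{D_N}\mathbb{E}^{L^{(N)}\sim\mu^{D_N}}\bigl\|L^\dagger-L^{(N)}\bigr\|^2_{L^2_{\nu'}(H;H)}=O(\rho_N)+o\Bigl(N^{-\frac{\alpha'+s}{\alpha+p}}\Bigr)\quad\text{as }N\to\infty,$$ where the constants in this bound depend on $L^\dagger$ (equivalently on $l^\dagger$). Furthermore, for every fixed $R>0$, $$\sup_{\|l^\dagger\|_{\mathcal{H}^s}\le R}\mathbb{E}^{D_N}\mathbb{E}^{L^{(N)}\sim\mu^{D_N}}\bigl\|L^\dagger-L^{(N)}\bigr\|^2_{L^2_{\nu'}(H;H)}=O\Bigl(\rho_N+N^{-\frac{\alpha'+s}{\alpha+p}}\Bigr)\quad\text{as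 }N\to\infty.$$ Both assertions also hold with $\mathbb{E}^{D_N}\mathbb{E}^{L^{(N)}\sim\mu^{D_N}}\|L^\dagger-L^{(N)}\|^2_{L^2_{\nu'}(H;H)}$ replaced by the posterior mean test error $\mathbb{E}^{D_N}\|L^\dagger-\bar L^{(N)}\|^2_{L^2_{\nu'}(H;H)}$.
   Context: $H$ is a real, separable, infinite-dimensional Hilbert space with inner product $\langle\cdot,\cdot\rangle$ and norm $\|\cdot\|$; $\{\varphi_j\}_{j\in\mathbb{N}}$ is a fixed known orthonormal basis of $H$. For $s\in\mathbb{R}$, $\mathcal{H}^s=\{v:\mathbb{N}\to\mathbb{R}:\|v\|_{\mathcal{H}^s}^2=\sum_jj^{2s}|v_j|^2<\infty\}$. For nonnegative sequences, $a_n=O(b_n)$ means $\limsup a_n/b_n<\infty$, $a_n=\Omega(b_n)$ means $b_n=O(a_n)$, $a_n=\Theta(b_n)$ means both, $a_n=o(b_n)$ means $a_n/b_n\to0$. Truth: $L^\dagger=\sum_jl_j^\dagger\varphi_j\otimes\varphi_j$ is a fixed, possibly unbounded, self-adjoint operator on $H$ with real eigenvalues $l_j^\dagger$ and domain $\{h\in H:\sum_j|l_j^\dagger|^2\langle\varphi_j,h\rangle^2<\infty\}$. Data: $\gamma>0$ is fixed; $\nu$ is a centered Borel probability measure on $H$ with finite second moment and strictly positive-definite trace-class covariance operator $\Lambda$; $x_1,\dots,x_N$ are i.i.d. from $\nu$; $g_{jn}=\langle\varphi_j,x_n\rangle$; $y_{jn}=g_{jn}l_j^\dagger+\gamma\xi_{jn}$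 for $j\in\mathbb{N}$, $1\le n\le N$, with $\xi_{jn}$ i.i.d. $\mathcal{N}(0,1)$ independent of $X=(x_1,\dots,x_N)$. $Y=\{y_{jn}\}$, $D_N=(X,Y)$, and $\mathbb{E}^{D_N}$ is expectation over the joint law of $D_N$. Prior and posterior: the prior on the eigenvalues is $\bigotimes_j\mathcal{N}(0,\sigma_j^2)$ with $\sigma_j^2>0$ for all $j$. The posterior on the eigenvalues is $\bigotimes_j\mathcal{N}(\bar l_j^{(N)},(\sigma_j^{(N)})^2)$ with $$\bar l_j^{(N)}=\frac{N\gamma^{-2}\sigma_j^2\,\frac1N\sum_{n}y_{jn}g_{jn}}{1+N\gamma^{-2}\sigma_j^2\,\frac1N\sum_ng_{jn}^2},\qquad(\sigma_j^{(N)})^2=\frac{\sigma_j^2}{1+N\gamma^{-2}\sigma_j^2\,\frac1N\sum_ng_{jn}^2}.$$ $\mu^{D_N}$ is the law of $L^{(N)}=\sum_jl_j^{(N)}\varphi_j\otimes\varphi_j$ with $\{l_j^{(N)}\}$ drawn from this posterior; $\bar L^{(N)}=\sum_j\bar l_j^{(N)}\varphi_j\otimes\varphi_j$ is the posterior mean. Test distribution: $\nu'$ is a centered Borel probability measure with bounded covariance operator $\Lambda'\in\mathcal{L}(H)$ (possibly not trace-class). For $T=\sum_jt_j\varphi_j\otimes\varphi_j$, $\|T\|^2_{L^2_{\nu'}(H;H)}=\mathbb{E}^{x\sim\nu'}\|Tx\|^2=\sum_j\vartheta_j'^2t_j^2$, where $\vartheta_j'^2=\langle\varphi_j,\Lambda'\varphi_j\rangle$.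 Assumption (M): $x\sim\nu$ has Karhunen–Loève expansion $x=\sum_k\lambda_k\zeta_k\phi_k$, where $\{\phi_k\}$ is an orthonormal eigenbasis of $\Lambda$ with nonincreasing eigenvalues $\lambda_k^2$, and the zero mean, unit variance random variables $\{\zeta_k\}$ are independent, have finite fourth moments, and satisfy $\mathbb{E}[\zeta_k^4]=O(1)$ as $k\to\infty$. Moreover, there is a constant $C$ such that $\limsup_{N\to\infty}\mathbb{E}\bigl[(\frac1N\sum_{n=1}^Ng_{jn}^2)^{-4}\bigr]\le C\langle\varphi_j,\Lambda\varphi_j\rangle^{-4}$ for all $j\in\mathbb{N}$. *)

theory Defs
  imports "HOL-Probability.Probability" "HOL-Library.Landau_Symbols"
begin

text \<open>
  Sequences are indexed from 0 here, so the mathematical index \<open>j = 1, 2, \<dots>\<close> is \<open>Suc j\<close>: every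
  weight \<open>j powr a\<close> becomes \<open>real (Suc j) powr a\<close>. Likewise the samples are numbered
  \<open>0, \<dots>, N - 1\<close>.

  A Hilbert space type of sort \<open>{real_inner, banach, second_countable_topology}\<close> is real, complete
  and separable; it is infinite-dimensional because it has an orthonormal basis indexed by
  \<open>nat\<close>.
\<close>

definition orthonormal_basis :: "(nat \<Rightarrow> 'h::real_inner) \<Rightarrow> bool" where
  "orthonormal_basis \<phi> \<longleftrightarrow>
     (\<forall>i j. inner (\<phi> i) (\<phi> j) = (if i = j then 1 else 0)) \<and> closure (span (range \<phi>)) = UNIV"

definition Hs :: "real \<Rightarrow> (nat \<Rightarrow> real) set" where
  "Hs s = {v. summable (\<lambda>j. real (Suc j) powr (2 * s) * \<bar>v j\<bar>\<^sup>2)}"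

definition Hs_norm :: "real \<Rightarrow> (nat \<Rightarrow> real) \<Rightarrow> real" where
  "Hs_norm s v = sqrt (\<Sum>j. real (Suc j) powr (2 * s) * \<bar>v j\<bar>\<^sup>2)"

section \<open>Training distribution\<close>

definition covariance_operator :: "'h::real_inner measure \<Rightarrow> ('h \<Rightarrow> 'h) \<Rightarrow> bool" where
  "covariance_operator \<nu> \<Lambda> \<longleftrightarrow> bounded_linear \<Lambda> \<and>
     (\<forall>u v. integrable \<nu> (\<lambda>x. inner u x * inner v x) \<and>
            inner u (\<Lambda> v) = (LINT x|\<nu>. inner u x * inner v x))"

text \<open>The trace of \<open>\<Lambda>\<close> is the second moment of \<open>\<nu>\<close>, so that finiteness of the latter makes
  \<open>\<Lambda>\<close> trace-class.\<close>

definition training_distribution ::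
    "'h::{real_inner,banach,second_countable_topology} measure \<Rightarrow> ('h \<Rightarrow> 'h) \<Rightarrow> bool" where
  "training_distribution \<nu> \<Lambda> \<longleftrightarrow>
     prob_space \<nu> \<and> sets \<nu> = sets borel \<and>
     integrable \<nu> (\<lambda>x. (norm x)\<^sup>2) \<and> (LINT x|\<nu>. x) = 0 \<and>
     covariance_operator \<nu> \<Lambda> \<and> (\<forall>h. h \<noteq> 0 \<longrightarrow> inner h (\<Lambda> h) > 0)"

text \<open>The negative moment is an \<open>ennreal\<close>, where \<open>inverse 0 = \<infinity>\<close>.\<close>

definition moment_assumption ::
    "(nat \<Rightarrow> 'h) \<Rightarrow> 'h::{real_inner,banach,second_countable_topology} measure \<Rightarrow> ('h \<Rightarrow> 'h) \<Rightarrow> bool" where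
  "moment_assumption \<phi> \<nu> \<Lambda> \<longleftrightarrow>
     (\<exists>(\<psi> :: nat \<Rightarrow> 'h) (lam :: nat \<Rightarrow> real) (\<zeta> :: nat \<Rightarrow> 'h \<Rightarrow> real).
        orthonormal_basis \<psi> \<and> (\<forall>k. \<Lambda> (\<psi> k) = (lam k)\<^sup>2 *\<^sub>R \<psi> k) \<and> decseq (\<lambda>k. (lam k)\<^sup>2) \<and>
        (AE x in \<nu>. (\<lambda>k. (lam k * \<zeta> k x) *\<^sub>R \<psi> k) sums x) \<and>
        prob_space.indep_vars \<nu> (\<lambda>_. borel) \<zeta> UNIV \<and>
        (\<forall>k. integrable \<nu> (\<lambda>x. \<zeta> k x ^ 4) \<and>
             (LINT x|\<nu>. \<zeta> k x) = 0 \<and> (LINT x|\<nu>. (\<zeta> k x)\<^sup>2) = 1) \<and>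
        (\<lambda>k. LINT x|\<nu>. \<zeta> k x ^ 4) \<in> O(\<lambda>_. 1)) \<and>
     (\<exists>C::real. \<forall>j.
        limsup (\<lambda>N. \<integral>\<^sup>+ X. inverse (ennreal (1 / real N * (\<Sum>n<N. (inner (\<phi> j) (X n))\<^sup>2))) ^ 4
                      \<partial>(\<Pi>\<^sub>M n\<in>{..<N}. \<nu>))
        \<le> ennreal (C * inner (\<phi> j) (\<Lambda> (\<phi> j)) powi (-4)))"

section \<open>Data and posterior\<close>

definition normal_law :: "real \<Rightarrow> real \<Rightarrow> real measure" where
  "normal_law m sd = density lborel (\<lambda>x. ennreal (normal_density m sd x))"

type_synonym 'h data = "(nat \<Rightarrow> 'h) \<times> (nat \<times> nat \<Rightarrow> real)"

definition data_space :: "nat \<Rightarrow> 'h::real_normed_vector data measure" where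
  "data_space N = (\<Pi>\<^sub>M n\<in>{..<N}. borel) \<Otimes>\<^sub>M (\<Pi>\<^sub>M jn\<in>UNIV \<times> {..<N}. borel)"

text \<open>Joint law of \<open>(X, Y)\<close>, where \<open>X\<close> and the noise \<open>\<xi>\<close> have their product law.\<close>

definition data_law ::
    "(nat \<Rightarrow> 'h) \<Rightarrow> real \<Rightarrow> 'h::{real_inner,banach,second_countable_topology} measure
      \<Rightarrow> (nat \<Rightarrow> real) \<Rightarrow> nat \<Rightarrow> 'h data measure" where
  "data_law \<phi> \<gamma> \<nu> l N =
     distr ((\<Pi>\<^sub>M n\<in>{..<N}. \<nu>) \<Otimes>\<^sub>M (\<Pi>\<^sub>M jn\<in>UNIV \<times> {..<N}. normal_law 0 1)) (data_space N)
       (\<lambda>(X, \<xi>). (X, \<lambda>(j, n)\<in>UNIV \<times> {..<N}. inner (\<phi> j) (X n) * l j + \<gamma> * \<xi> (j, n)))"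

definition post_mean ::
    "(nat \<Rightarrow> 'h::real_inner) \<Rightarrow> real \<Rightarrow> (nat \<Rightarrow> real) \<Rightarrow> nat \<Rightarrow> 'h data \<Rightarrow> nat \<Rightarrow> real" where
  "post_mean \<phi> \<gamma> \<sigma> N D j =
     (case D of (X, Y) \<Rightarrow>
       (real N * \<gamma> powi (-2) * (\<sigma> j)\<^sup>2 * (1 / real N * (\<Sum>n<N. Y (j, n) * inner (\<phi> j) (X n)))) /
       (1 + real N * \<gamma> powi (-2) * (\<sigma> j)\<^sup>2 * (1 / real N * (\<Sum>n<N. (inner (\<phi> j) (X n))\<^sup>2))))"

definition post_var ::
    "(nat \<Rightarrow> 'h::real_inner) \<Rightarrow> real \<Rightarrow> (nat \<Rightarrow> real) \<Rightarrow> nat \<Rightarrow> 'h data \<Rightarrow> nat \<Rightarrow> real" where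
  "post_var \<phi> \<gamma> \<sigma> N D j =
     (case D of (X, Y) \<Rightarrow>
       (\<sigma> j)\<^sup>2 /
       (1 + real N * \<gamma> powi (-2) * (\<sigma> j)\<^sup>2 * (1 / real N * (\<Sum>n<N. (inner (\<phi> j) (X n))\<^sup>2))))"

text \<open>The posterior law of the operator, given as the law of its sequence of eigenvalues.\<close>

definition posterior ::
    "(nat \<Rightarrow> 'h::real_inner) \<Rightarrow> real \<Rightarrow> (nat \<Rightarrow> real) \<Rightarrow> nat \<Rightarrow> 'h data \<Rightarrow> (nat \<Rightarrow> real) measure" where
  "posterior \<phi> \<gamma> \<sigma> N D =
     (\<Pi>\<^sub>M j\<in>UNIV. normal_law (post_mean \<phi> \<gamma> \<sigma> N D j) (sqrt (post_var \<phi> \<gamma> \<sigma> N D j)))"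

section \<open>Test distribution and test error\<close>

text \<open>
  The test covariance need not be trace-class, in which case the test distribution may only live
  on a space larger than \<open>H\<close> (Gaussian white noise, for instance). Test inputs \<open>x\<close> are therefore
  represented by their coordinate sequences \<open>c j = \<langle>\<phi> j, x\<rangle>\<close> and \<open>\<nu>'\<close> is a Borel probability measure
  on the space of all sequences; a Borel measure on \<open>H\<close> itself enters through its image
  under \<open>x \<mapsto> (\<lambda>j. inner (\<phi> j) x)\<close>.
\<close>

definition test_distribution ::
    "(nat \<Rightarrow> 'h::real_inner) \<Rightarrow> (nat \<Rightarrow> real) measure \<Rightarrow> ('h \<Rightarrow> 'h) \<Rightarrow> bool" where
  "test_distribution \<phi> \<nu>' \<Lambda>' \<longleftrightarrow>
     prob_space \<nu>' \<and> sets \<nu>' = sets borel \<and> bounded_linear \<Lambda>' \<and>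
     (\<forall>j. integrable \<nu>' (\<lambda>c. c j) \<and> (LINT c|\<nu>'. c j) = 0) \<and>
     (\<forall>i j. integrable \<nu>' (\<lambda>c. c i * c j) \<and>
            inner (\<phi> i) (\<Lambda>' (\<phi> j)) = (LINT c|\<nu>'. c i * c j))"

text \<open>The possibly unbounded operator \<open>T = (\<Sum>j. t j \<phi> j \<otimes> \<phi> j)\<close>, as a function of the coordinate
  sequence of its argument, and \<open>\<parallel>T x\<parallel>\<^sup>2\<close>, which is infinite for \<open>x\<close> outside the domain of \<open>T\<close>.\<close>

definition diag_dom :: "(nat \<Rightarrow> real) \<Rightarrow> (nat \<Rightarrow> real) set" where
  "diag_dom t = {c. summable (\<lambda>j. \<bar>t j\<bar>\<^sup>2 * (c j)\<^sup>2)}"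

definition diag_op :: "(nat \<Rightarrow> 'h::real_normed_vector) \<Rightarrow> (nat \<Rightarrow> real) \<Rightarrow> (nat \<Rightarrow> real) \<Rightarrow> 'h" where
  "diag_op \<phi> t c = (\<Sum>j. (t j * c j) *\<^sub>R \<phi> j)"

definition diag_sqnorm :: "(nat \<Rightarrow> 'h::real_normed_vector) \<Rightarrow> (nat \<Rightarrow> real) \<Rightarrow> (nat \<Rightarrow> real) \<Rightarrow> ennreal" where
  "diag_sqnorm \<phi> t c = (if c \<in> diag_dom t then ennreal ((norm (diag_op \<phi> t c))\<^sup>2) else \<infinity>)"

definition L2_sqnorm :: "(nat \<Rightarrow> 'h::real_normed_vector) \<Rightarrow> (nat \<Rightarrow> real) measure \<Rightarrow> (nat \<Rightarrow> real) \<Rightarrow> ennreal" where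
  "L2_sqnorm \<phi> \<nu>' t = (\<integral>\<^sup>+ c. diag_sqnorm \<phi> t c \<partial>\<nu>')"

definition posterior_test_error ::
    "(nat \<Rightarrow> 'h) \<Rightarrow> real \<Rightarrow> (nat \<Rightarrow> real) \<Rightarrow> 'h::{real_inner,banach,second_countable_topology} measure
      \<Rightarrow> (nat \<Rightarrow> real) measure \<Rightarrow> (nat \<Rightarrow> real) \<Rightarrow> nat \<Rightarrow> ennreal" where
  "posterior_test_error \<phi> \<gamma> \<sigma> \<nu> \<nu>' ldag N =
     (\<integral>\<^sup>+ D. (\<integral>\<^sup>+ l. L2_sqnorm \<phi> \<nu>' (\<lambda>j. ldag j - l j) \<partial>posterior \<phi> \<gamma> \<sigma> N D) \<partial>data_law \<phi> \<gamma> \<nu> ldag N)"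

definition mean_test_error ::
    "(nat \<Rightarrow> 'h) \<Rightarrow> real \<Rightarrow> (nat \<Rightarrow> real) \<Rightarrow> 'h::{real_inner,banach,second_countable_topology} measure
      \<Rightarrow> (nat \<Rightarrow> real) measure \<Rightarrow> (nat \<Rightarrow> real) \<Rightarrow> nat \<Rightarrow> ennreal" where
  "mean_test_error \<phi> \<gamma> \<sigma> \<nu> \<nu>' ldag N =
     (\<integral>\<^sup>+ D. L2_sqnorm \<phi> \<nu>' (\<lambda>j. ldag j - post_mean \<phi> \<gamma> \<sigma> N D j) \<partial>data_law \<phi> \<gamma> \<nu> ldag N)"

section \<open>Rates\<close>

definition \<rho> :: "real \<Rightarrow> real \<Rightarrow> real \<Rightarrow> nat \<Rightarrow> real" where
  "\<rho> \<alpha> \<alpha>' p N =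
     (if \<alpha>' < \<alpha> + 1/2 then real N powr (- (1 - (\<alpha> + 1/2 - \<alpha>') / (\<alpha> + p)))
      else if \<alpha>' = \<alpha> + 1/2 then real N powr (-1) * ln (real N)
      else real N powr (-1))"

text \<open>Landau notation for \<open>ennreal\<close>-valued sequences; in particular they are eventually finite.\<close>

definition is_bigo :: "(nat \<Rightarrow> ennreal) \<Rightarrow> (nat \<Rightarrow> real) \<Rightarrow> bool" where
  "is_bigo f b \<longleftrightarrow>
     (\<exists>a. (\<forall>N. 0 \<le> a N) \<and> a \<in> O(b) \<and> (\<forall>\<^sub>F N in sequentially. f N = ennreal (a N)))"

definition is_bigo_plus_smallo :: "(nat \<Rightarrow> ennreal) \<Rightarrow> (nat \<Rightarrow> real) \<Rightarrow> (nat \<Rightarrow> real) \<Rightarrow> bool" where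
  "is_bigo_plus_smallo f b r \<longleftrightarrow>
     (\<exists>a c. (\<forall>N. 0 \<le> a N) \<and> (\<forall>N. 0 \<le> c N) \<and> a \<in> O(b) \<and> c \<in> o(r) \<and>
            (\<forall>\<^sub>F N in sequentially. f N = ennreal (a N + c N)))"

end

theory Submission
  imports Defs
begin

text \<open>
  Both errors are sums over the coordinates \<open>j\<close>, and in coordinate \<open>j\<close> the posterior is that of a
  scalar linear regression. Write \<open>A\<^sub>j\<close> for the empirical signal-to-noise ratio
  \<open>\<gamma>\<^sup>-\<^sup>2 \<sigma>\<^sub>j\<^sup>2 (\<Sum>n<N. g\<^sub>j\<^sub>n\<^sup>2)\<close>. Conditionally on the inputs, the squared bias of the posterior mean
  is \<open>l\<^sub>j\<^sup>2 / (1 + A\<^sub>j)\<^sup>2\<close>, its variance is \<open>\<sigma>\<^sub>j\<^sup>2 A\<^sub>j / (1 + A\<^sub>j)\<^sup>2\<close> and the posterior variance is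
  \<open>\<sigma>\<^sub>j\<^sup>2 / (1 + A\<^sub>j)\<close>, so that everything is dominated by \<open>(l\<^sub>j\<^sup>2 + 2 \<sigma>\<^sub>j\<^sup>2) / (1 + A\<^sub>j)\<close>
  (\<open>test_errors_le\<close>). It remains to average the shrinkage factor \<open>1 / (1 + A\<^sub>j)\<close> over the inputs
  and to sum over \<open>j\<close>.

  The average has to be controlled uniformly in \<open>j\<close>. The Karhunen-Loeve expansion writes
  \<open>\<langle>\<phi>\<^sub>j, x\<rangle>\<close> as a series of independent variables with bounded kurtosis; a sum of such variables has
  bounded kurtosis again, with the same constant if that is at least \<open>3\<close>
  (\<open>linear_functional_fourth_moment\<close>). A nonnegative
  variable with bounded second moment has a light lower tail, and Chernoff's bound shows that
  \<open>\<Sum>n<N. g\<^sub>j\<^sub>n\<^sup>2\<close> falls below half of its mean with probability at most \<open>exp (- c N)\<close>, where \<open>c\<close> does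
  not depend on \<open>j\<close>. Hence the average of \<open>1 / (1 + A\<^sub>j)\<close> is at most a constant times
  \<open>1 / (1 + N j\<^sup>-\<^sup>2\<^sup>\<kappa>) + 1 / N\<close> with \<open>\<kappa> = \<alpha> + p\<close> (\<open>expected_shrinkage_le\<close>, combined with the
  asymptotics of \<open>\<sigma>\<^sub>j\<^sup>2\<close> and \<open>\<langle>\<phi>\<^sub>j, \<Lambda> \<phi>\<^sub>j\<rangle>\<close>).

  The variance series \<open>\<Sum>j. j\<^sup>-\<^sup>2\<^sup>(\<^sup>\<alpha>\<^sup>'\<^sup>+\<^sup>p\<^sup>) / (1 + N j\<^sup>-\<^sup>2\<^sup>\<kappa>)\<close> is split at \<open>j = N\<^sup>1\<^sup>/\<^sup>(\<^sup>2\<^sup>\<kappa>\<^sup>)\<close>, where the two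
  terms of the denominator balance: the tail always contributes \<open>N\<close> to the power
  \<open>- (1 - (\<alpha> + 1/2 - \<alpha>') / \<kappa>)\<close>, and the head is \<open>N\<^sup>-\<^sup>1\<close> times a partial sum of \<open>j\<^sup>2\<^sup>(\<^sup>\<alpha>\<^sup>-\<^sup>\<alpha>\<^sup>'\<^sup>)\<close>, which
  grows, diverges logarithmically or converges; these are the three cases of \<open>\<rho>\<close>
  (\<open>variance_sum_bigo\<close>). In the bias series the terms \<open>j\<^sup>2\<^sup>s l\<^sub>j\<^sup>2\<close> are multiplied by
  \<open>j\<^sup>-\<^sup>2\<^sup>\<kappa>\<^sup>r / (1 + N j\<^sup>-\<^sup>2\<^sup>\<kappa>)\<close> with \<open>r = (\<alpha>' + s) / \<kappa>\<close>. This factor is at most \<open>N\<^sup>-\<^sup>r\<close> if \<open>r \<le> 1\<close> and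
  at most \<open>N\<^sup>-\<^sup>1 = O(\<rho>\<^sub>N)\<close> otherwise, which gives the uniform bound. If \<open>r < 1\<close> then \<open>N\<^sup>r\<close> times the
  factor also tends to \<open>0\<close> for each fixed \<open>j\<close>, and dominated convergence turns \<open>O\<close> into \<open>o\<close> for a
  fixed truth.
\<close>

section \<open>Power sums and the rates\<close>

text \<open>By the mean value theorem the right-hand side is \<open>z powr a\<close> for some \<open>z\<close> between \<open>x\<close> and
  \<open>x + 1\<close>, and \<open>z powr a\<close> decreases in \<open>z\<close>. The case \<open>x = 0\<close> is the first term of the partial sums below.\<close>

lemma powr_le_telescope_pos:
  fixes a x :: real
  assumes "-1 < a" "a \<le> 0" "0 \<le> x"
  shows "(x + 1) powr a \<le> ((x + 1) powr (a + 1) - x powr (a + 1)) / (a + 1)"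
proof -
  have cont: "continuous_on {x..x+1} (\<lambda>z. z powr (a + 1))"
    using assms by (intro continuous_on_powr' continuous_intros) auto
  have der: "((\<lambda>z. z powr (a + 1)) has_derivative (\<lambda>h. h * ((a + 1) * z powr a))) (at z)"
    if "x < z" "z < x + 1" for z
  proof -
    have "((\<lambda>z. z powr (a + 1)) has_real_derivative (a + 1) * z powr a) (at z)"
      using that assms has_real_derivative_powr[of z "a + 1"] by simp
    then show ?thesis by (simp add: has_field_derivative_def mult_commute_abs)
  qed
  obtain z where z: "x < z" "z < x + 1"
      "(x+1) powr (a+1) - x powr (a+1) = (x + 1 - x) * ((a + 1) * z powr a)"
    using mvt[OF _ cont der] by auto
  have "(x + 1) powr a \<le> z powr a"
    using z assms by (intro powr_mono2') auto
  moreover have "((x + 1) powr (a + 1) - x powr (a + 1)) / (a + 1) = z powr a"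
    using z assms by (auto simp: field_simps)
  ultimately show ?thesis by simp
qed

lemma powr_le_telescope_neg:
  fixes b x :: real
  assumes "1 < b" "0 < x"
  shows "(x + 1) powr (- b) \<le> (x powr (1 - b) - (x + 1) powr (1 - b)) / (b - 1)"
proof -
  have "\<exists>z. x < z \<and> z < x + 1 \<and> (x+1) powr (1-b) - x powr (1-b) = (x + 1 - x) * ((1 - b) * z powr (-b))"
    by (rule MVT2) (use assms in \<open>auto intro!: derivative_eq_intros\<close>)
  then obtain z where z: "x < z" "z < x + 1" "(x+1) powr (1-b) - x powr (1-b) = (1 - b) * z powr (-b)"
    by auto
  have "(x + 1) powr (-b) \<le> z powr (-b)"
    using z assms by (intro powr_mono2') auto
  moreover have "(x powr (1 - b) - (x + 1) powr (1 - b)) / (b - 1) = z powr (-b)"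
    using z assms by (auto simp: field_simps)
  ultimately show ?thesis by simp
qed

lemma powr_partial_sum_le:
  fixes a :: real
  assumes "-1 < a"
  obtains C where "C > 0" "\<And>n. (\<Sum>j<n. real (Suc j) powr a) \<le> C * real n powr (a + 1)"
proof (cases "a \<le> 0")
  case True
  have "(\<Sum>j<n. real (Suc j) powr a) \<le> 1 / (a + 1) * real n powr (a + 1)" for n
  proof -
    have "(\<Sum>j<n. real (Suc j) powr a)
        \<le> (\<Sum>j<n. (real (Suc j) powr (a + 1) - real j powr (a + 1)) / (a + 1))"
      using assms True powr_le_telescope_pos[of a "real _"]
      by (intro sum_mono) (simp add: add.commute)
    also have "\<dots> = (\<Sum>j<n. real (Suc j) powr (a + 1) - real j powr (a + 1)) / (a + 1)"
      by (simp add: sum_divide_distrib)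
    also have "\<dots> = real n powr (a + 1) / (a + 1)"
      using assms by (subst sum_lessThan_telescope) simp
    finally show ?thesis by simp
  qed
  with assms show ?thesis by (intro that[of "1 / (a + 1)"]) auto
next
  case False
  have "(\<Sum>j<n. real (Suc j) powr a) \<le> 1 * real n powr (a + 1)" for n
  proof -
    have "(\<Sum>j<n. real (Suc j) powr a) \<le> (\<Sum>j<n. real n powr a)"
      using False by (intro sum_mono powr_mono2) auto
    also have "\<dots> = real n powr (a + 1)"
      by (cases "n = 0") (auto simp: powr_add)
    finally show ?thesis by simp
  qed
  then show ?thesis by (intro that[of 1]) auto
qed

text \<open>The inequality \<open>ln x \<le> x - 1\<close> at \<open>x = n / (n + 1)\<close> makes \<open>1 / (n + 1)\<close> a difference of
  consecutive logarithms.\<close>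

lemma harmonic_partial_sum_le:
  assumes "n \<ge> 1"
  shows "(\<Sum>j<n. real (Suc j) powr (-1)) \<le> 1 + ln (real n)"
  using assms
proof (induction n rule: nat_induct_at_least)
  case base
  then show ?case by simp
next
  case (Suc n)
  have "ln (real n / real (Suc n)) \<le> real n / real (Suc n) - 1"
    using Suc by (intro ln_le_minus_one) auto
  then have "real (Suc n) powr (-1) \<le> ln (real (Suc n)) - ln (real n)"
    using Suc by (auto simp: ln_div powr_minus field_simps)
  with Suc show ?case by simp
qed

lemma powr_tail_sum:
  fixes b :: real
  assumes "1 < b" "n \<ge> 1"
  shows "summable (\<lambda>j. real (Suc j) powr (- b))"
    and "(\<Sum>j. real (Suc (j + n)) powr (- b)) \<le> real n powr (1 - b) / (b - 1)"
proof -
  show sm: "summable (\<lambda>j. real (Suc j) powr (- b))"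
    using assms summable_real_powr_iff[of "-b"]
      summable_iff_shift[of "\<lambda>j. real j powr (- b)" 1] by simp
  then have sm': "summable (\<lambda>j. real (Suc (j + n)) powr (- b))"
    using summable_iff_shift[of "\<lambda>j. real (Suc j) powr (- b)" n] by simp
  have "(\<Sum>j<m. real (Suc (j + n)) powr (- b)) \<le> real n powr (1 - b) / (b - 1)" for m
  proof -
    have "(\<Sum>j<m. real (Suc (j + n)) powr (- b)) \<le>
        (\<Sum>j<m. (real (j + n) powr (1 - b) - real (Suc j + n) powr (1 - b)) / (b - 1))"
      using assms powr_le_telescope_neg[of b "real (_ + n)"]
      by (intro sum_mono) (simp add: add.commute)
    also have "\<dots> = (\<Sum>j<m. real (j + n) powr (1 - b) - real (Suc j + n) powr (1 - b)) / (b - 1)"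
      by (simp add: sum_divide_distrib)
    also have "\<dots> = (real n powr (1 - b) - real (m + n) powr (1 - b)) / (b - 1)"
      by (subst sum_lessThan_telescope') simp
    also have "\<dots> \<le> real n powr (1 - b) / (b - 1)"
      using assms by (intro divide_right_mono) auto
    finally show ?thesis .
  qed
  with sm' show "(\<Sum>j. real (Suc (j + n)) powr (- b)) \<le> real n powr (1 - b) / (b - 1)"
    by (rule suminf_le_const)
qed

lemma powr_le_one_add:
  fixes u r :: real
  assumes "0 \<le> u" "0 < r" "r \<le> 1"
  shows "u powr r \<le> 1 + u"
proof (cases "u \<le> 1")
  case True
  then have "u powr r \<le> 1 powr r" using assms by (intro powr_mono2) auto
  with assms show ?thesis by simp
next
  case False
  then have "u powr r \<le> u powr 1" using assms by (intro powr_mono) auto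
  with False show ?thesis by simp
qed

text \<open>The shrinkage factor of coordinate \<open>j\<close> for the population signal-to-noise ratio, up to
  constants.\<close>

definition shrink :: "real \<Rightarrow> nat \<Rightarrow> nat \<Rightarrow> real" where
  "shrink \<kappa> N j = 1 / (1 + real N * real (Suc j) powr (- 2 * \<kappa>))"

lemma shrink_bounds: "0 < shrink \<kappa> N j" "shrink \<kappa> N j \<le> 1"
proof -
  have "0 \<le> real N * real (Suc j) powr (- 2 * \<kappa>)" by simp
  then have "1 \<le> 1 + real N * real (Suc j) powr (- 2 * \<kappa>)" by linarith
  then show "0 < shrink \<kappa> N j" "shrink \<kappa> N j \<le> 1"
    unfolding shrink_def by (simp_all only: divide_le_eq_1_pos zero_less_divide_1_iff)
qed

text \<open>With \<open>u = N j\<^sup>-\<^sup>2\<^sup>\<kappa>\<close> the left-hand side equals \<open>N\<^sup>-\<^sup>r u\<^sup>r / (1 + u)\<close>, and \<open>u\<^sup>r \<le> 1 + u\<close>.\<close>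

lemma shrink_le_interpolate:
  fixes r :: real
  assumes "0 < r" "r \<le> 1" "N \<ge> 1"
  shows "real (Suc j) powr (- 2 * \<kappa> * r) * shrink \<kappa> N j \<le> real N powr (- r)"
proof -
  define u where "u = real N * real (Suc j) powr (- 2 * \<kappa>)"
  have u: "u > 0" using assms by (simp add: u_def)
  have "real (Suc j) powr (- 2 * \<kappa> * r) = real N powr (- r) * u powr r"
    using assms by (simp add: u_def powr_mult powr_powr mult.assoc[symmetric] powr_add[symmetric]
        del: of_nat_Suc)
  then have "real (Suc j) powr (- 2 * \<kappa> * r) * shrink \<kappa> N j
      = real N powr (- r) * (u powr r / (1 + u))"
    by (simp add: shrink_def u_def)
  also have "\<dots> \<le> real N powr (- r) * 1"
    using powr_le_one_add[of u r] u assms by (intro mult_left_mono) auto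
  finally show ?thesis by simp
qed

lemma summable_powr_mult_shrink:
  assumes "1 < b"
  shows "summable (\<lambda>j. real (Suc j) powr (- b) * shrink \<kappa> N j)"
proof (rule summable_comparison_test_ev[OF always_eventually])
  show "summable (\<lambda>j. real (Suc j) powr (- b))"
    using powr_tail_sum(1)[of b 1] assms by simp
  show "\<forall>j. norm (real (Suc j) powr (- b) * shrink \<kappa> N j) \<le> real (Suc j) powr (- b)"
    using shrink_bounds by (auto simp: abs_mult less_imp_le intro!: mult_left_le)
qed

lemma eventually_one_le_ln:
  "eventually (\<lambda>N. 1 \<le> ln (real N)) sequentially"
proof -
  have "filterlim (\<lambda>N. ln (real N)) at_top sequentially"
    by (rule filterlim_compose[OF ln_at_top filterlim_real_sequentially])
  then show ?thesis by (simp add: filterlim_at_top)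
qed

lemma rho_nonneg: "N \<ge> 1 \<Longrightarrow> 0 \<le> \<rho> \<alpha> \<alpha>' p N"
  by (simp add: \<rho>_def)

text \<open>The rate \<open>1 / N\<close> is the fastest that \<open>\<rho>\<close> can attain, so every remainder of that order can be
  absorbed into \<open>\<rho>\<close>.\<close>

lemma inverse_in_bigo_rho:
  assumes "0 < \<alpha> + p"
  shows "(\<lambda>N. 1 / real N) \<in> O(\<rho> \<alpha> \<alpha>' p)"
proof (rule bigoI[where c = 1])
  show "\<forall>\<^sub>F N in sequentially. norm (1 / real N) \<le> 1 * norm (\<rho> \<alpha> \<alpha>' p N)"
    using eventually_one_le_ln eventually_ge_at_top[of 1]
  proof eventually_elim
    case (elim N)
    have "1 / real N \<le> \<rho> \<alpha> \<alpha>' p N"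
    proof -
      have eq: "1 / real N = real N powr (-1)" using elim by (simp add: powr_minus field_simps)
      show ?thesis
      proof (cases "\<alpha>' < \<alpha> + 1/2")
        case True
        then have "(\<alpha> + 1/2 - \<alpha>') / (\<alpha> + p) \<ge> 0" using assms by simp
        then have "real N powr (-1) \<le> real N powr (- (1 - (\<alpha> + 1/2 - \<alpha>') / (\<alpha> + p)))"
          using elim by (intro powr_mono) auto
        with True eq show ?thesis by (simp add: \<rho>_def)
      next
        case False
        have "real N powr (-1) * 1 \<le> real N powr (-1) * ln (real N)"
          using elim by (intro mult_left_mono) auto
        with False eq show ?thesis by (simp add: \<rho>_def)
      qed
    qed
    then show ?case using elim rho_nonneg[of N] by simp
  qed
qed

text \<open>Below the cutoff the shrinkage factor is about \<open>j\<^sup>2\<^sup>\<kappa> / N\<close>, which leaves a partial sum of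
  \<open>j\<^sup>2\<^sup>(\<^sup>\<alpha>\<^sup>-\<^sup>\<alpha>\<^sup>'\<^sup>)\<close>. The exponent is above, equal to or below \<open>-1\<close> precisely in the three cases of \<open>\<rho>\<close>.\<close>

lemma head_sum_bigo_rho:
  fixes \<alpha> \<alpha>' p :: real
  defines "\<kappa> \<equiv> \<alpha> + p"
  assumes "0 < \<kappa>"
  shows "\<exists>C>0. \<forall>\<^sub>F N in sequentially. \<forall>n. 1 \<le> n \<and> real n \<le> real N powr (1 / (2 * \<kappa>)) \<longrightarrow>
    1 / real N * (\<Sum>j<n. real (Suc j) powr (2 * (\<alpha> - \<alpha>'))) \<le> C * \<rho> \<alpha> \<alpha>' p N"
proof -
  consider "\<alpha>' < \<alpha> + 1/2" | "\<alpha>' = \<alpha> + 1/2" | "\<alpha>' > \<alpha> + 1/2" by linarith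
  then show ?thesis
  proof cases
    case 1
    obtain C where C: "C > 0"
        "\<And>n. (\<Sum>j<n. real (Suc j) powr (2 * (\<alpha> - \<alpha>'))) \<le> C * real n powr (2 * (\<alpha> - \<alpha>') + 1)"
      using powr_partial_sum_le[of "2 * (\<alpha> - \<alpha>')"] 1 by auto
    have "1 / real N * (\<Sum>j<n. real (Suc j) powr (2 * (\<alpha> - \<alpha>'))) \<le> C * \<rho> \<alpha> \<alpha>' p N"
      if N: "N \<ge> 1" and n: "1 \<le> n" "real n \<le> real N powr (1 / (2 * \<kappa>))" for N n
    proof -
      have "real n powr (2 * (\<alpha> - \<alpha>') + 1) \<le> (real N powr (1 / (2 * \<kappa>))) powr (2 * (\<alpha> - \<alpha>') + 1)"
        using n 1 by (intro powr_mono2) auto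
      also have "\<dots> = real N powr ((\<alpha> + 1/2 - \<alpha>') / \<kappa>)"
        using assms by (simp add: powr_powr field_simps)
      finally have "1 / real N * (\<Sum>j<n. real (Suc j) powr (2 * (\<alpha> - \<alpha>')))
          \<le> 1 / real N * (C * real N powr ((\<alpha> + 1/2 - \<alpha>') / \<kappa>))"
        using C(1) by (intro mult_left_mono order_trans[OF C(2)]) auto
      also have "\<dots> = C * (real N powr (-1) * real N powr ((\<alpha> + 1/2 - \<alpha>') / \<kappa>))"
        using N by (simp add: powr_minus field_simps)
      also have "\<dots> = C * real N powr (- (1 - (\<alpha> + 1/2 - \<alpha>') / \<kappa>))"
        by (subst powr_add[symmetric]) simp
      also have "\<dots> = C * \<rho> \<alpha> \<alpha>' p N" using 1 by (simp add: \<rho>_def \<kappa>_def)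
      finally show ?thesis .
    qed
    with C(1) show ?thesis
      by (intro exI[of _ C] conjI eventually_mono[OF eventually_ge_at_top[of 1]]) auto
  next
    case 2
    have "1 / real N * (\<Sum>j<n. real (Suc j) powr (2 * (\<alpha> - \<alpha>'))) \<le> (1 + 1 / (2 * \<kappa>)) * \<rho> \<alpha> \<alpha>' p N"
      if N: "N \<ge> 1" "1 \<le> ln (real N)" and n: "1 \<le> n" "real n \<le> real N powr (1 / (2 * \<kappa>))" for N n
    proof -
      have "(\<Sum>j<n. real (Suc j) powr (2 * (\<alpha> - \<alpha>'))) = (\<Sum>j<n. real (Suc j) powr (-1))"
        using 2 by simp
      also have "\<dots> \<le> 1 + ln (real n)" using n by (intro harmonic_partial_sum_le)
      also have "ln (real n) \<le> ln (real N powr (1 / (2 * \<kappa>)))"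
        using n N by (subst ln_le_cancel_iff) auto
      also have "\<dots> = 1 / (2 * \<kappa>) * ln (real N)" using N by (simp add: ln_powr)
      also have "1 + 1 / (2 * \<kappa>) * ln (real N) \<le> (1 + 1 / (2 * \<kappa>)) * ln (real N)"
        using N by (simp add: distrib_right)
      finally have "1 / real N * (\<Sum>j<n. real (Suc j) powr (2 * (\<alpha> - \<alpha>')))
          \<le> 1 / real N * ((1 + 1 / (2 * \<kappa>)) * ln (real N))"
        by (intro mult_left_mono) auto
      also have "\<dots> = (1 + 1 / (2 * \<kappa>)) * \<rho> \<alpha> \<alpha>' p N"
        using 2 N by (simp add: \<rho>_def powr_minus field_simps)
      finally show ?thesis .
    qed
    moreover have "0 < 1 + 1 / (2 * \<kappa>)" using assms by (intro add_pos_pos) auto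
    ultimately show ?thesis
      by (intro exI[of _ "1 + 1 / (2 * \<kappa>)"] conjI
          eventually_mono[OF eventually_conj[OF eventually_ge_at_top[of 1] eventually_one_le_ln]]) auto
  next
    case 3
    define C where "C = (\<Sum>j. real (Suc j) powr (2 * (\<alpha> - \<alpha>')))"
    have sm: "summable (\<lambda>j. real (Suc j) powr (2 * (\<alpha> - \<alpha>')))"
      using powr_tail_sum(1)[of "2 * (\<alpha>' - \<alpha>)" 1] 3 by (simp add: algebra_simps)
    have "C > 0" unfolding C_def using sm by (intro suminf_pos) auto
    moreover have "1 / real N * (\<Sum>j<n. real (Suc j) powr (2 * (\<alpha> - \<alpha>'))) \<le> C * \<rho> \<alpha> \<alpha>' p N"
      if "N \<ge> 1" for N n
    proof -
      have "(\<Sum>j<n. real (Suc j) powr (2 * (\<alpha> - \<alpha>'))) \<le> C"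
        unfolding C_def by (intro sum_le_suminf sm) auto
      then have "1 / real N * (\<Sum>j<n. real (Suc j) powr (2 * (\<alpha> - \<alpha>'))) \<le> 1 / real N * C"
        by (intro mult_left_mono) auto
      also have "\<dots> = C * \<rho> \<alpha> \<alpha>' p N"
        using 3 that by (simp add: \<rho>_def powr_minus field_simps)
      finally show ?thesis .
    qed
    ultimately show ?thesis
      by (intro exI[of _ C] conjI eventually_mono[OF eventually_ge_at_top[of 1]]) auto
  qed
qed

text \<open>The exponent on the left is the one of the first case of \<open>\<rho>\<close>; in the other two cases it is
  at most \<open>-1\<close>.\<close>

lemma tail_rate_le_rho:
  fixes \<alpha> \<alpha>' p :: real
  defines "\<kappa> \<equiv> \<alpha> + p"
  assumes "0 < \<kappa>"
  shows "\<forall>\<^sub>F N in sequentially. real N powr (- ((2 * (\<alpha>' + p) - 1) / (2 * \<kappa>))) \<le> \<rho> \<alpha> \<alpha>' p N"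
  using eventually_one_le_ln eventually_ge_at_top[of 1]
proof eventually_elim
  case (elim N)
  have eq: "(2 * (\<alpha>' + p) - 1) / (2 * \<kappa>) = 1 - (\<alpha> + 1/2 - \<alpha>') / \<kappa>"
    using assms by (simp add: field_simps)
  show ?case
  proof (cases "\<alpha>' < \<alpha> + 1/2")
    case True
    then show ?thesis unfolding \<rho>_def eq by (simp add: \<kappa>_def)
  next
    case False
    then have "(\<alpha> + 1/2 - \<alpha>') / \<kappa> \<le> 0"
      using assms by (simp add: divide_nonpos_pos)
    then have "real N powr (- ((2 * (\<alpha>' + p) - 1) / (2 * \<kappa>))) \<le> real N powr (-1)"
      using elim unfolding eq by (intro powr_mono) auto
    also have "\<dots> \<le> \<rho> \<alpha> \<alpha>' p N"
      using False elim mult_left_mono[of 1 "ln (real N)" "real N powr (-1)"] by (simp add: \<rho>_def)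
    finally show ?thesis .
  qed
qed

text \<open>Split the series at \<open>n \<approx> N\<^sup>1\<^sup>/\<^sup>(\<^sup>2\<^sup>\<kappa>\<^sup>)\<close>: up to \<open>n\<close> use \<open>shrink \<le> j\<^sup>2\<^sup>\<kappa> / N\<close>, beyond \<open>n\<close> use
  \<open>shrink \<le> 1\<close>.\<close>

lemma variance_sum_bigo:
  fixes \<alpha> \<alpha>' p :: real
  assumes "0 < \<alpha> + p" "1/2 < \<alpha>' + p"
  shows "(\<lambda>N. \<Sum>j. real (Suc j) powr (- (2 * (\<alpha>' + p))) * shrink (\<alpha> + p) N j) \<in> O(\<rho> \<alpha> \<alpha>' p)"
proof -
  define \<kappa> where "\<kappa> = \<alpha> + p"
  define b where "b = 2 * (\<alpha>' + p)"
  have \<kappa>: "\<kappa> > 0" and b: "b > 1" using assms by (auto simp: \<kappa>_def b_def)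
  obtain C where C: "C > 0" and ev: "\<forall>\<^sub>F N in sequentially. \<forall>n. 1 \<le> n \<and> real n \<le> real N powr (1 / (2 * \<kappa>)) \<longrightarrow>
    1 / real N * (\<Sum>j<n. real (Suc j) powr (2 * (\<alpha> - \<alpha>'))) \<le> C * \<rho> \<alpha> \<alpha>' p N"
    using head_sum_bigo_rho[of \<alpha> p \<alpha>'] assms unfolding \<kappa>_def by auto
  define C' where "C' = C + 2 powr (b - 1) / (b - 1)"
  have "\<forall>\<^sub>F N in sequentially.
      norm (\<Sum>j. real (Suc j) powr (- b) * shrink \<kappa> N j) \<le> C' * norm (\<rho> \<alpha> \<alpha>' p N)"
    using ev tail_rate_le_rho[of \<alpha> p \<alpha>', folded \<kappa>_def b_def, OF \<kappa>] eventually_ge_at_top[of 1]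
  proof eventually_elim
    case (elim N)
    define T where "T = real N powr (1 / (2 * \<kappa>))"
    \<comment> \<open>At \<open>T\<close> the two terms of \<open>1 + N T\<^sup>-\<^sup>2\<^sup>\<kappa>\<close> are equal.\<close>
    define n where "n = nat \<lfloor>T\<rfloor>"
    have T: "T \<ge> 1" using elim \<kappa> by (simp add: T_def ge_one_powr_ge_zero)
    have n: "1 \<le> n" "real n \<le> T" using T by (auto simp: n_def le_nat_iff)
    have "T < real n + 1" unfolding n_def using T by linarith
    with n have T2: "T \<le> 2 * real n" by linarith
    let ?f = "\<lambda>j. real (Suc j) powr (- b) * shrink \<kappa> N j"
    have sm: "summable ?f" using summable_powr_mult_shrink b by blast
    have head: "(\<Sum>j<n. ?f j) \<le> C * \<rho> \<alpha> \<alpha>' p N"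
    proof -
      have "?f j \<le> 1 / real N * real (Suc j) powr (2 * (\<alpha> - \<alpha>'))" for j
      proof -
        have "shrink \<kappa> N j \<le> 1 / (real N * real (Suc j) powr (- 2 * \<kappa>))"
          unfolding shrink_def using elim by (intro divide_left_mono mult_pos_pos add_pos_nonneg) auto
        then have "?f j \<le> real (Suc j) powr (- b) * (1 / (real N * real (Suc j) powr (- 2 * \<kappa>)))"
          by (intro mult_left_mono) auto
        also have "\<dots> = 1 / real N * (real (Suc j) powr (- b) / real (Suc j) powr (- 2 * \<kappa>))"
          by simp
        also have "\<dots> = 1 / real N * real (Suc j) powr (2 * (\<alpha> - \<alpha>'))"
          by (subst powr_diff[symmetric]) (simp add: b_def \<kappa>_def algebra_simps)
        finally show ?thesis .
      qed
      then have "(\<Sum>j<n. ?f j) \<le> (\<Sum>j<n. 1 / real N * real (Suc j) powr (2 * (\<alpha> - \<alpha>')))"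
        by (intro sum_mono) auto
      also have "\<dots> = 1 / real N * (\<Sum>j<n. real (Suc j) powr (2 * (\<alpha> - \<alpha>')))"
        by (simp only: sum_distrib_left)
      also have "\<dots> \<le> C * \<rho> \<alpha> \<alpha>' p N"
        using elim(1) n by (auto simp: T_def)
      finally show ?thesis .
    qed
    have tail: "(\<Sum>j. ?f (j + n)) \<le> 2 powr (b - 1) / (b - 1) * \<rho> \<alpha> \<alpha>' p N"
    proof -
      have "(\<Sum>j. ?f (j + n)) \<le> (\<Sum>j. real (Suc (j + n)) powr (- b))"
      proof (rule suminf_le)
        show "?f (j + n) \<le> real (Suc (j + n)) powr (- b)" for j
          using shrink_bounds(2) by (simp add: mult_left_le)
        show "summable (\<lambda>j. ?f (j + n))" using summable_ignore_initial_segment[OF sm] .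
        show "summable (\<lambda>j. real (Suc (j + n)) powr - b)"
          using summable_ignore_initial_segment[OF powr_tail_sum(1)[OF b order_refl], of n] .
      qed
      also have "\<dots> \<le> real n powr (1 - b) / (b - 1)"
        using powr_tail_sum(2)[OF b n(1)] .
      also have "\<dots> \<le> (T / 2) powr (1 - b) / (b - 1)"
        using b n T T2 by (intro divide_right_mono powr_mono2') auto
      also have "\<dots> = 2 powr (b - 1) / (b - 1) * T powr (1 - b)"
        using T by (simp add: powr_divide powr_diff field_simps)
      also have "T powr (1 - b) = real N powr (- ((b - 1) / (2 * \<kappa>)))"
        by (simp add: T_def powr_powr) (simp add: minus_divide_left)
      also have "2 powr (b - 1) / (b - 1) * \<dots> \<le> 2 powr (b - 1) / (b - 1) * \<rho> \<alpha> \<alpha>' p N"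
        using elim b by (intro mult_left_mono) auto
      finally show ?thesis .
    qed
    have "(\<Sum>j. ?f j) = (\<Sum>j. ?f (j + n)) + (\<Sum>j<n. ?f j)"
      using sm by (rule suminf_split_initial_segment)
    also have "\<dots> \<le> C' * \<rho> \<alpha> \<alpha>' p N"
      using head tail by (simp add: C'_def distrib_right)
    finally have "(\<Sum>j. ?f j) \<le> C' * \<rho> \<alpha> \<alpha>' p N" .
    moreover have "0 \<le> (\<Sum>j. ?f j)"
      using sm shrink_bounds(1) by (intro suminf_nonneg) (auto simp: less_imp_le)
    ultimately show ?case using rho_nonneg[of N] elim by simp
  qed
  then show ?thesis unfolding \<kappa>_def b_def by (rule bigoI)
qed

text \<open>For \<open>r \<le> 1\<close> this is the interpolation inequality. For larger \<open>r\<close> the shrinkage saturates: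
  the interpolation inequality is applied with exponent \<open>1\<close>, and the rate is \<open>1 / N\<close>.\<close>

lemma bias_sum_le:
  fixes w :: "nat \<Rightarrow> real"
  assumes "summable w" "\<And>j. 0 \<le> w j" "0 < r" "0 \<le> \<kappa>" "N \<ge> 1"
  shows "summable (\<lambda>j. w j * (real (Suc j) powr (- 2 * \<kappa> * r) * shrink \<kappa> N j))"
    and "(\<Sum>j. w j * (real (Suc j) powr (- 2 * \<kappa> * r) * shrink \<kappa> N j))
           \<le> (1 / real N + real N powr (- r)) * (\<Sum>j. w j)"
proof -
  let ?q = "1 / real N + real N powr (- r)"
  have q: "real (Suc j) powr (- 2 * \<kappa> * r) * shrink \<kappa> N j \<le> ?q" for j
  proof (cases "r \<le> 1")
    case True
    then show ?thesis
      using shrink_le_interpolate[OF assms(3) True assms(5), of j \<kappa>] by (simp add: add_increasing)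
  next
    case False
    have "\<kappa> * 1 \<le> \<kappa> * r" using False assms by (intro mult_left_mono) auto
    then have "real (Suc j) powr (- 2 * \<kappa> * r) * shrink \<kappa> N j
        \<le> real (Suc j) powr (- 2 * \<kappa> * 1) * shrink \<kappa> N j"
      using shrink_bounds(1)[of \<kappa> N j] by (intro mult_right_mono powr_mono) auto
    also have "\<dots> \<le> real N powr (- 1)" using assms by (intro shrink_le_interpolate) auto
    also have "\<dots> \<le> ?q" using assms by (simp add: powr_minus field_simps)
    finally show ?thesis .
  qed
  have nn: "0 \<le> w j * (real (Suc j) powr (- 2 * \<kappa> * r) * shrink \<kappa> N j)" for j
    using assms(2) shrink_bounds(1)[of \<kappa> N j] by simp
  have le: "w j * (real (Suc j) powr (- 2 * \<kappa> * r) * shrink \<kappa> N j) \<le> ?q * w j" for j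
    using q[of j] assms(2)[of j] by (subst mult.commute) (rule mult_right_mono)
  have sq: "summable (\<lambda>j. ?q * w j)" using assms(1) by (rule summable_mult)
  show sm: "summable (\<lambda>j. w j * (real (Suc j) powr (- 2 * \<kappa> * r) * shrink \<kappa> N j))"
    using nn le sq by (intro summable_comparison_test_ev[OF always_eventually sq]) auto
  have "(\<Sum>j. w j * (real (Suc j) powr (- 2 * \<kappa> * r) * shrink \<kappa> N j)) \<le> (\<Sum>j. ?q * w j)"
    using le sm sq by (rule suminf_le)
  also have "\<dots> = ?q * (\<Sum>j. w j)" using assms(1) by (rule suminf_mult)
  finally show "(\<Sum>j. w j * (real (Suc j) powr (- 2 * \<kappa> * r) * shrink \<kappa> N j)) \<le> ?q * (\<Sum>j. w j)" .
qed

text \<open>After division by \<open>N\<^sup>-\<^sup>r\<close> the terms are dominated by \<open>w j\<close> and each of them tends to \<open>0\<close>, like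
  \<open>N\<^sup>r\<^sup>-\<^sup>1\<close>; Tannery's theorem (dominated convergence for series) applies.\<close>

lemma bias_sum_smallo:
  fixes w :: "nat \<Rightarrow> real"
  assumes "summable w" "\<And>j. 0 \<le> w j" "0 < r" "r < 1"
  shows "(\<lambda>N. \<Sum>j. w j * (real (Suc j) powr (- 2 * \<kappa> * r) * shrink \<kappa> N j))
            \<in> o(\<lambda>N. real N powr (- r))"
proof (rule smalloI_tendsto)
  define a where "a j N = w j * (real (Suc j) powr (- 2 * \<kappa> * r) * shrink \<kappa> N j) / real N powr (- r)" for j N
  have lim: "(\<lambda>N. a j N) \<longlonglongrightarrow> 0" for j
  proof -
    define c where "c = real (Suc j) powr (- 2 * \<kappa>)"
    have c: "c > 0" by (simp add: c_def)
    have "(\<lambda>N. w j * real (Suc j) powr (- 2 * \<kappa> * r) * (1 / c) * real N powr (- (1 - r))) \<longlonglongrightarrow>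
        w j * real (Suc j) powr (- 2 * \<kappa> * r) * (1 / c) * 0"
      using assms by (intro tendsto_intros tendsto_neg_powr filterlim_real_sequentially) auto
    then have lim0: "(\<lambda>N. w j * real (Suc j) powr (- 2 * \<kappa> * r) * (1 / c) * real N powr (- (1 - r))) \<longlonglongrightarrow> 0"
      by simp
    show ?thesis
    proof (rule tendsto_sandwich[OF _ _ tendsto_const lim0])
      show "\<forall>\<^sub>F N in sequentially. 0 \<le> a j N"
        unfolding a_def using assms shrink_bounds(1) by (intro always_eventually) (simp add: less_imp_le)
      show "\<forall>\<^sub>F N in sequentially. a j N \<le> w j * real (Suc j) powr (- 2 * \<kappa> * r) * (1 / c) * real N powr (- (1 - r))"
        using eventually_ge_at_top[of 1]
      proof eventually_elim
        case (elim N)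
        have "shrink \<kappa> N j \<le> 1 / (c * real N)"
          unfolding shrink_def c_def using elim
          by (intro divide_left_mono mult_pos_pos add_pos_nonneg) auto
        then have "a j N \<le> w j * (real (Suc j) powr (- 2 * \<kappa> * r) * (1 / (c * real N))) / real N powr (- r)"
          unfolding a_def using assms by (intro divide_right_mono mult_left_mono) auto
        also have "\<dots> = w j * real (Suc j) powr (- 2 * \<kappa> * r) * (1 / c) * real N powr (- (1 - r))"
          using elim by (simp add: powr_diff powr_minus field_simps)
        finally show ?case .
      qed
    qed
  qed
  have bound: "norm (a j N) \<le> w j" if "N \<ge> 1" for j N
  proof -
    have "w j * (real (Suc j) powr (- 2 * \<kappa> * r) * shrink \<kappa> N j) \<le> w j * real N powr (- r)"
      using assms that by (intro mult_left_mono shrink_le_interpolate) auto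
    then have "a j N \<le> w j" unfolding a_def using that by (simp add: divide_le_eq)
    moreover have "0 \<le> a j N" unfolding a_def using assms shrink_bounds(1)[of \<kappa> N j] by simp
    ultimately show ?thesis by simp
  qed
  have "\<forall>\<^sub>F (j, N) in at_top \<times>\<^sub>F sequentially. norm (a j N) \<le> w j"
    using eventually_prodI[OF eventually_True, OF eventually_ge_at_top[of 1]]
    by (rule eventually_mono) (use bound in auto)
  then have "(\<lambda>N. \<Sum>j. a j N) \<longlonglongrightarrow> (\<Sum>j. 0)"
    using tannerys_theorem[of a "\<lambda>_. 0" sequentially w] lim assms(1) by auto
  moreover have "\<forall>\<^sub>F N in sequentially. (\<Sum>j. a j N)
      = (\<Sum>j. w j * (real (Suc j) powr (- 2 * \<kappa> * r) * shrink \<kappa> N j)) / real N powr (- r)"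
    using eventually_ge_at_top[of 1]
  proof eventually_elim
    case (elim N)
    have "summable (\<lambda>j. a j N)"
      using bound[OF elim] by (intro summable_comparison_test_ev[OF always_eventually assms(1)]) auto
    then have "summable (\<lambda>j. real N powr (- r) * a j N)" by (rule summable_mult)
    then have "summable (\<lambda>j. w j * (real (Suc j) powr (- 2 * \<kappa> * r) * shrink \<kappa> N j))"
      using elim by (simp add: a_def)
    then show ?case unfolding a_def by (rule suminf_divide)
  qed
  ultimately show "(\<lambda>N. (\<Sum>j. w j * (real (Suc j) powr (- 2 * \<kappa> * r) * shrink \<kappa> N j)) / real N powr (- r)) \<longlonglongrightarrow> 0"
    by (simp add: filterlim_cong)
  show "\<forall>\<^sub>F N in sequentially. real N powr (- r) \<noteq> 0"
    using eventually_ge_at_top[of 1] by eventually_elim auto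
qed

section \<open>Fourth moments of linear functionals of the input\<close>

lemma (in prob_space) integrable_power_le:
  fixes X :: "'a \<Rightarrow> real"
  assumes [measurable]: "X \<in> borel_measurable M" and "integrable M (\<lambda>x. X x ^ m)" "even m" "k \<le> m"
  shows "integrable M (\<lambda>x. X x ^ k)"
proof (rule Bochner_Integration.integrable_bound)
  show "integrable M (\<lambda>x. 1 + X x ^ m)" using assms by simp
  have "\<bar>y\<bar> ^ k \<le> 1 + y ^ m" for y :: real
  proof (cases "\<bar>y\<bar> \<le> 1")
    case True
    then have "\<bar>y\<bar> ^ k \<le> 1" by (simp add: power_le_one)
    then show ?thesis using \<open>even m\<close> by (simp add: add_increasing2 zero_le_even_power)
  next
    case False
    then have "\<bar>y\<bar> ^ k \<le> \<bar>y\<bar> ^ m" using assms by (intro power_increasing) auto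
    then show ?thesis using \<open>even m\<close> by (simp add: power_even_abs)
  qed
  then show "AE x in M. norm (X x ^ k) \<le> norm (1 + X x ^ m)"
    using \<open>even m\<close> by (intro always_eventually allI) (auto simp: power_abs intro: order_trans[OF _ abs_ge_self])
qed simp

lemma (in prob_space) indep_var_power_product:
  fixes X Y :: "'a \<Rightarrow> real"
  assumes indep: "indep_var borel X borel Y"
    and "integrable M (\<lambda>x. X x ^ a)" "integrable M (\<lambda>x. Y x ^ b)"
  shows "integrable M (\<lambda>x. X x ^ a * Y x ^ b)"
    and "expectation (\<lambda>x. X x ^ a * Y x ^ b) = expectation (\<lambda>x. X x ^ a) * expectation (\<lambda>x. Y x ^ b)"
proof -
  have "indep_var borel ((\<lambda>y. y ^ a) \<circ> X) borel ((\<lambda>y. y ^ b) \<circ> Y)"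
    using indep by (rule indep_var_compose) auto
  then have i: "indep_var borel (\<lambda>x. X x ^ a) borel (\<lambda>x. Y x ^ b)" by (simp add: comp_def)
  show "integrable M (\<lambda>x. X x ^ a * Y x ^ b)"
    by (rule indep_var_integrable[OF i assms(2,3)])
  show "expectation (\<lambda>x. X x ^ a * Y x ^ b) = expectation (\<lambda>x. X x ^ a) * expectation (\<lambda>x. Y x ^ b)"
    by (rule indep_var_lebesgue_integral[OF i assms(2,3)])
qed

lemma (in prob_space) indep_sum_second_moment:
  fixes X :: "'i \<Rightarrow> 'a \<Rightarrow> real"
  assumes "finite I" "indep_vars (\<lambda>_. borel) X I"
    and "\<And>i. i \<in> I \<Longrightarrow> integrable M (\<lambda>x. (X i x)\<^sup>2)"
    and "\<And>i. i \<in> I \<Longrightarrow> expectation (X i) = 0"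
  shows "integrable M (\<lambda>x. (\<Sum>i\<in>I. X i x)\<^sup>2) \<and> integrable M (\<lambda>x. \<Sum>i\<in>I. X i x) \<and>
    expectation (\<lambda>x. \<Sum>i\<in>I. X i x) = 0 \<and>
    expectation (\<lambda>x. (\<Sum>i\<in>I. X i x)\<^sup>2) = (\<Sum>i\<in>I. expectation (\<lambda>x. (X i x)\<^sup>2))"
  using assms
proof (induction I)
  case empty
  then show ?case by simp
next
  case (insert i F)
  define S where "S x = (\<Sum>i\<in>F. X i x)" for x
  have indep: "indep_var borel (X i) borel S"
    unfolding S_def using insert by (intro indep_vars_sum) auto
  have [measurable]: "X i \<in> borel_measurable M" using insert.prems(1) by (auto simp: indep_vars_def)
  have IH: "integrable M (\<lambda>x. (S x)\<^sup>2)" "integrable M S" "expectation S = 0"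
      "expectation (\<lambda>x. (S x)\<^sup>2) = (\<Sum>i\<in>F. expectation (\<lambda>x. (X i x)\<^sup>2))"
    using insert.IH insert.prems indep_vars_subset[OF insert.prems(1), of F] unfolding S_def by auto
  have iX: "integrable M (\<lambda>x. (X i x)\<^sup>2)" "integrable M (X i)" "expectation (X i) = 0"
    using insert.prems integrable_power_le[of "X i" 2 1] by auto
  have P: "integrable M (\<lambda>x. X i x * S x)" "expectation (\<lambda>x. X i x * S x) = 0"
    using indep_var_power_product[OF indep, of 1 1] iX IH by auto
  have sum: "(\<Sum>i\<in>insert i F. X i x) = X i x + S x" for x
    using insert by (simp add: S_def)
  have sq: "(X i x + S x)\<^sup>2 = (X i x)\<^sup>2 + 2 * (X i x * S x) + (S x)\<^sup>2" for x
    by (simp add: power2_sum)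
  show ?case
    unfolding sum sq using insert.hyps IH iX P by simp
qed

text \<open>A kurtosis bound \<open>K \<ge> 3\<close> is inherited by sums of independent centred variables. In the
  expansion of \<open>(X + S)\<^sup>4\<close> the odd terms vanish, and the mixed term \<open>6 E[X\<^sup>2] E[S\<^sup>2]\<close> fits into
  \<open>K (E[X\<^sup>2] + E[S\<^sup>2])\<^sup>2\<close> as soon as \<open>6 \<le> 2 K\<close>.\<close>

lemma (in prob_space) indep_sum_fourth_moment:
  fixes X :: "'i \<Rightarrow> 'a \<Rightarrow> real"
  assumes "3 \<le> K" "finite I" "indep_vars (\<lambda>_. borel) X I"
    and "\<And>i. i \<in> I \<Longrightarrow> integrable M (\<lambda>x. X i x ^ 4)"
    and "\<And>i. i \<in> I \<Longrightarrow> expectation (X i) = 0"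
    and "\<And>i. i \<in> I \<Longrightarrow> expectation (\<lambda>x. X i x ^ 4) \<le> K * (expectation (\<lambda>x. (X i x)\<^sup>2))\<^sup>2"
  shows "integrable M (\<lambda>x. (\<Sum>i\<in>I. X i x) ^ 4) \<and>
    expectation (\<lambda>x. (\<Sum>i\<in>I. X i x) ^ 4) \<le> K * (\<Sum>i\<in>I. expectation (\<lambda>x. (X i x)\<^sup>2))\<^sup>2"
  using assms(2-)
proof (induction I)
  case empty
  then show ?case by simp
next
  case (insert i F)
  define S where "S x = (\<Sum>i\<in>F. X i x)" for x
  define V where "V = (\<Sum>i\<in>F. expectation (\<lambda>x. (X i x)\<^sup>2))"
  define v where "v = expectation (\<lambda>x. (X i x)\<^sup>2)"
  have indep: "indep_var borel (X i) borel S"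
    unfolding S_def using insert by (intro indep_vars_sum) auto
  have mX[measurable]: "X k \<in> borel_measurable M" if "k \<in> insert i F" for k
    using insert.prems(1) that by (auto simp: indep_vars_def)
  have [measurable]: "S \<in> borel_measurable M"
    unfolding S_def by (intro borel_measurable_sum mX) auto
  have iX: "integrable M (\<lambda>x. X k x ^ n)" if "n \<le> 4" "k \<in> insert i F" for n k
    by (rule integrable_power_le[OF mX insert.prems(2)]) (use that in auto)
  have indF: "indep_vars (\<lambda>_. borel) X F"
    using insert.prems(1) by (rule indep_vars_subset) auto
  have IH: "integrable M (\<lambda>x. S x ^ 4)" "expectation (\<lambda>x. S x ^ 4) \<le> K * V\<^sup>2"
    using insert.IH[OF indF insert.prems(2-)] unfolding S_def V_def by simp_all
  have iS: "integrable M (\<lambda>x. S x ^ n)" if "n \<le> 4" for n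
    by (rule integrable_power_le[OF _ IH(1) _ that]) auto
  have S2: "expectation S = 0" "expectation (\<lambda>x. (S x)\<^sup>2) = V"
    using indep_sum_second_moment[OF insert.hyps(1) indF iX insert.prems(3)]
    unfolding S_def V_def by simp_all
  have P: "has_bochner_integral M (\<lambda>x. X i x ^ a * S x ^ b)
      (expectation (\<lambda>x. X i x ^ a) * expectation (\<lambda>x. S x ^ b))"
    if "a \<le> 4" "b \<le> 4" for a b
    unfolding has_bochner_integral_iff
    using indep_var_power_product[OF indep iX[OF that(1)] iS[OF that(2)]] by blast
  have X1: "expectation (X i) = 0" using insert.prems by simp
  have sum: "(\<Sum>i\<in>insert i F. X i x) = X i x + S x" for x
    using insert.hyps by (simp add: S_def)
  have pow: "X i x ^ 4 + 4 * (X i x ^ 3 * S x ^ 1) + 6 * (X i x ^ 2 * S x ^ 2)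
      + 4 * (X i x ^ 1 * S x ^ 3) + S x ^ 4 = (X i x + S x) ^ 4" for x
    by algebra
  have "has_bochner_integral M (\<lambda>x. X i x ^ 4 + 4 * (X i x ^ 3 * S x ^ 1) + 6 * (X i x ^ 2 * S x ^ 2)
      + 4 * (X i x ^ 1 * S x ^ 3) + S x ^ 4)
      (expectation (\<lambda>x. X i x ^ 4) + 4 * (expectation (\<lambda>x. X i x ^ 3) * expectation (\<lambda>x. S x ^ 1))
        + 6 * (expectation (\<lambda>x. X i x ^ 2) * expectation (\<lambda>x. S x ^ 2))
        + 4 * (expectation (\<lambda>x. X i x ^ 1) * expectation (\<lambda>x. S x ^ 3)) + expectation (\<lambda>x. S x ^ 4))"
    by (intro has_bochner_integral_add has_bochner_integral_mult_right P
        has_bochner_integral_integrable[OF IH(1)] has_bochner_integral_integrable[OF iX]) simp_all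
  then have hb: "has_bochner_integral M (\<lambda>x. (X i x + S x) ^ 4)
      (expectation (\<lambda>x. X i x ^ 4) + 6 * (v * V) + expectation (\<lambda>x. S x ^ 4))"
    unfolding pow by (simp add: X1 S2 v_def)
  have int: "integrable M (\<lambda>x. (X i x + S x) ^ 4)" using hb by (rule integrable.intros)
  have "expectation (\<lambda>x. (X i x + S x) ^ 4)
      = expectation (\<lambda>x. X i x ^ 4) + 6 * (v * V) + expectation (\<lambda>x. S x ^ 4)"
    using hb by (rule has_bochner_integral_integral_eq)
  also have "\<dots> \<le> K * v\<^sup>2 + 6 * (v * V) + K * V\<^sup>2"
    using IH insert.prems(4)[of i] by (simp add: v_def)
  also have "\<dots> \<le> K * v\<^sup>2 + 2 * K * (v * V) + K * V\<^sup>2"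
  proof -
    have "0 \<le> v * V" unfolding v_def V_def
      by (intro mult_nonneg_nonneg sum_nonneg Bochner_Integration.integral_nonneg) auto
    with assms(1) have "3 * (v * V) \<le> K * (v * V)" by (rule mult_right_mono)
    then show ?thesis by linarith
  qed
  also have "\<dots> = K * (v + V)\<^sup>2" by (simp add: power2_sum algebra_simps)
  finally have "expectation (\<lambda>x. (X i x + S x) ^ 4) \<le> K * (v + V)\<^sup>2" .
  with int insert.hyps show ?case unfolding sum V_def v_def by simp
qed

text \<open>Decompose \<open>h\<close> into its projection \<open>q\<close> onto the first \<open>n\<close> eigenvectors and a remainder \<open>v\<close>.
  The image of \<open>q\<close> is orthogonal to \<open>v\<close>, so the quadratic form of \<open>h\<close> is the diagonal sum plus the
  nonnegative value at \<open>v\<close>.\<close>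

lemma psd_diagonal_le:
  fixes \<Lambda> :: "'h::real_inner \<Rightarrow> 'h" and \<psi> :: "nat \<Rightarrow> 'h"
  assumes lin: "linear \<Lambda>" and psd: "\<And>v. 0 \<le> inner v (\<Lambda> v)"
    and ortho: "\<And>i j. inner (\<psi> i) (\<psi> j) = (if i = j then 1 else 0)"
    and eig: "\<And>k. \<Lambda> (\<psi> k) = \<mu> k *\<^sub>R \<psi> k"
    and sym: "\<And>u v. inner u (\<Lambda> v) = inner v (\<Lambda> u)"
  shows "(\<Sum>k<n. \<mu> k * (inner h (\<psi> k))\<^sup>2) \<le> inner h (\<Lambda> h)"
proof -
  define c where "c k = inner h (\<psi> k)" for k
  define q where "q = (\<Sum>k<n. c k *\<^sub>R \<psi> k)"
  define v where "v = h - q"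
  have Lq: "\<Lambda> q = (\<Sum>k<n. (c k * \<mu> k) *\<^sub>R \<psi> k)"
    unfolding q_def by (simp add: linear_sum[OF lin] linear_scale[OF lin] eig)
  have q\<psi>: "inner q (\<psi> k) = c k" if "k < n" for k
    unfolding q_def using that by (simp add: inner_sum_left ortho if_distrib sum.delta cong: if_cong)
  have vL: "inner v (\<Lambda> q) = 0"
    unfolding Lq v_def by (auto simp: inner_sum_right inner_diff_left q\<psi> c_def intro!: sum.neutral)
  have qL: "inner q (\<Lambda> q) = (\<Sum>k<n. \<mu> k * (c k)\<^sup>2)"
    unfolding Lq by (auto simp: inner_sum_right q\<psi> power2_eq_square intro!: sum.cong)
  have "h = q + v" by (simp add: v_def)
  then have "inner h (\<Lambda> h) = inner q (\<Lambda> q) + inner q (\<Lambda> v) + inner v (\<Lambda> q) + inner v (\<Lambda> v)"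
    by (simp add: linear_add[OF lin] inner_add_left inner_add_right)
  also have "inner q (\<Lambda> v) = inner v (\<Lambda> q)" by (rule sym)
  finally show ?thesis using vL qL psd[of v] by (simp add: c_def)
qed

text \<open>Fatou's lemma, in the form needed to pass a moment bound to an almost sure limit.\<close>

lemma nn_integral_le_of_AE_limit:
  assumes [measurable]: "\<And>n. f n \<in> borel_measurable M"
    and lim: "AE x in M. (\<lambda>n. f n x) \<longlonglongrightarrow> (g x :: ennreal)"
    and le: "\<And>n. (\<integral>\<^sup>+ x. f n x \<partial>M) \<le> C"
  shows "(\<integral>\<^sup>+ x. g x \<partial>M) \<le> C"
proof -
  have "(\<integral>\<^sup>+ x. g x \<partial>M) = (\<integral>\<^sup>+ x. liminf (\<lambda>n. f n x) \<partial>M)"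
    using lim by (intro nn_integral_cong_AE) (auto elim!: eventually_mono dest: lim_imp_Liminf[rotated])
  also have "\<dots> \<le> liminf (\<lambda>n. \<integral>\<^sup>+ x. f n x \<partial>M)"
    by (intro nn_integral_liminf) simp
  also have "\<dots> \<le> limsup (\<lambda>n. \<integral>\<^sup>+ x. f n x \<partial>M)" by (simp add: Liminf_le_Limsup)
  also have "\<dots> \<le> C" using le by (intro Limsup_bounded always_eventually) auto
  finally show ?thesis .
qed

text \<open>The partial sums of the Karhunen-Loeve series of \<open>\<langle>h, x\<rangle>\<close> have kurtosis at most \<open>K\<close> and
  variance at most \<open>\<langle>h, \<Lambda> h\<rangle>\<close>; Fatou's lemma carries the bound to the limit. The point is that \<open>K\<close>
  is the same for all \<open>h\<close>.\<close>

lemma linear_functional_fourth_moment: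
  fixes \<phi> :: "nat \<Rightarrow> 'h::{real_inner,banach,second_countable_topology}"
  assumes tr: "training_distribution \<nu> \<Lambda>" and mom: "moment_assumption \<phi> \<nu> \<Lambda>"
  obtains K where "3 \<le> K" "\<And>h. (\<integral>\<^sup>+ x. ennreal (inner h x ^ 4) \<partial>\<nu>) \<le> ennreal (K * (inner h (\<Lambda> h))\<^sup>2)"
proof -
  from mom obtain \<psi> :: "nat \<Rightarrow> 'h" and lam :: "nat \<Rightarrow> real" and \<zeta> :: "nat \<Rightarrow> 'h \<Rightarrow> real"
    where ortho: "orthonormal_basis \<psi>" and eig: "\<And>k. \<Lambda> (\<psi> k) = (lam k)\<^sup>2 *\<^sub>R \<psi> k"
      and KL: "AE x in \<nu>. (\<lambda>k. (lam k * \<zeta> k x) *\<^sub>R \<psi> k) sums x"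
      and indep: "prob_space.indep_vars \<nu> (\<lambda>_. borel) \<zeta> UNIV"
      and int4: "\<And>k. integrable \<nu> (\<lambda>x. \<zeta> k x ^ 4)" and mean: "\<And>k. (LINT x|\<nu>. \<zeta> k x) = 0"
      and var: "\<And>k. (LINT x|\<nu>. (\<zeta> k x)\<^sup>2) = 1"
      and bigo: "(\<lambda>k. LINT x|\<nu>. \<zeta> k x ^ 4) \<in> O(\<lambda>_. 1)"
    unfolding moment_assumption_def by blast
  interpret prob_space \<nu> using tr by (simp add: training_distribution_def)
  have setsnu[measurable_cong]: "sets \<nu> = sets borel" using tr by (simp add: training_distribution_def)
  have cov: "covariance_operator \<nu> \<Lambda>" using tr by (simp add: training_distribution_def)
  have [measurable]: "\<zeta> k \<in> borel_measurable \<nu>" for k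
    using indep by (auto simp: indep_vars_def)
  obtain K where K: "3 \<le> K" "\<And>k. expectation (\<lambda>x. \<zeta> k x ^ 4) \<le> K"
  proof -
    from bigo obtain c where "\<forall>\<^sub>F k in sequentially. norm (expectation (\<lambda>x. \<zeta> k x ^ 4)) \<le> c * norm (1::real)"
      by (elim landau_o.bigE)
    then have "Bseq (\<lambda>k. expectation (\<lambda>x. \<zeta> k x ^ 4))" by (intro BfunI[where K = c]) simp
    then obtain B where B: "\<And>k. norm (expectation (\<lambda>x. \<zeta> k x ^ 4)) \<le> B" by (auto simp: Bseq_def)
    have "expectation (\<lambda>x. \<zeta> k x ^ 4) \<le> max 3 B" for k using B[of k] by simp
    then show ?thesis by (intro that[of "max 3 B"]) auto
  qed
  have psd: "0 \<le> inner v (\<Lambda> v)" for v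
    using cov by (auto simp: covariance_operator_def intro!: Bochner_Integration.integral_nonneg)
  have sym: "inner u (\<Lambda> v) = inner v (\<Lambda> u)" for u v
    using cov by (auto simp: covariance_operator_def mult.commute)
  have lin: "linear \<Lambda>" using cov by (simp add: covariance_operator_def bounded_linear.linear)
  have "(\<integral>\<^sup>+ x. ennreal (inner h x ^ 4) \<partial>\<nu>) \<le> ennreal (K * (inner h (\<Lambda> h))\<^sup>2)" for h
  proof (rule nn_integral_le_of_AE_limit)
    define a where "a k = lam k * inner h (\<psi> k)" for k
    define X where "X k x = a k * \<zeta> k x" for k x
    have [measurable]: "X k \<in> borel_measurable \<nu>" for k unfolding X_def by measurable
    show "(\<lambda>x. ennreal ((\<Sum>k<n. X k x) ^ 4)) \<in> borel_measurable \<nu>" for n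
      by measurable
    show "AE x in \<nu>. (\<lambda>n. ennreal ((\<Sum>k<n. X k x) ^ 4)) \<longlonglongrightarrow> ennreal (inner h x ^ 4)"
      using KL
    proof eventually_elim
      case (elim x)
      have "(\<lambda>k. inner h ((lam k * \<zeta> k x) *\<^sub>R \<psi> k)) sums inner h x"
        using elim by (rule bounded_linear.sums[OF bounded_linear_inner_right])
      then have "(\<lambda>k. X k x) sums inner h x"
        by (simp add: X_def a_def mult_ac)
      then show ?case unfolding sums_def by (intro tendsto_intros)
    qed
    have "indep_vars (\<lambda>_. borel) X UNIV"
      unfolding X_def by (rule indep_vars_compose2[OF indep]) auto
    then have indepX: "indep_vars (\<lambda>_. borel) X {..<n}" for n
      by (rule indep_vars_subset) simp
    have X2: "expectation (\<lambda>x. (X k x)\<^sup>2) = (a k)\<^sup>2" for k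
      by (simp add: X_def power_mult_distrib var)
    have X4: "expectation (\<lambda>x. X k x ^ 4) \<le> K * (expectation (\<lambda>x. (X k x)\<^sup>2))\<^sup>2" for k
      unfolding X2 using mult_right_mono[OF K(2)[of k], of "a k ^ 4"]
      by (simp add: X_def power_mult_distrib mult_ac power_mult[symmetric])
    have "X k = (\<lambda>x. a k * \<zeta> k x)" for k by (simp add: X_def fun_eq_iff)
    then have X0: "expectation (X k) = 0" "integrable \<nu> (\<lambda>x. X k x ^ 4)" for k
      by (simp_all add: power_mult_distrib mean int4)
    fix n
    have F: "integrable \<nu> (\<lambda>x. (\<Sum>k<n. X k x) ^ 4)"
        "expectation (\<lambda>x. (\<Sum>k<n. X k x) ^ 4) \<le> K * (\<Sum>k<n. (a k)\<^sup>2)\<^sup>2"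
      using indep_sum_fourth_moment[OF K(1) finite_lessThan indepX X0(2) X0(1) X4] by (simp_all add: X2)
    have "(\<Sum>k<n. (a k)\<^sup>2) \<le> inner h (\<Lambda> h)"
      using psd_diagonal_le[OF lin psd, where \<psi> = \<psi> and \<mu> = "\<lambda>k. (lam k)\<^sup>2"] ortho eig sym
      by (simp add: orthonormal_basis_def a_def power_mult_distrib)
    then have "K * (\<Sum>k<n. (a k)\<^sup>2)\<^sup>2 \<le> K * (inner h (\<Lambda> h))\<^sup>2"
      using K(1) by (intro mult_left_mono power_mono sum_nonneg) auto
    with F show "(\<integral>\<^sup>+ x. ennreal ((\<Sum>k<n. X k x) ^ 4) \<partial>\<nu>) \<le> ennreal (K * (inner h (\<Lambda> h))\<^sup>2)"
      by (subst nn_integral_eq_integral) (auto intro!: ennreal_leI zero_le_even_power)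
  qed
  with K(1) show ?thesis by (rule that)
qed

section \<open>The expected shrinkage factor\<close>

text \<open>Integrate the elementary bound \<open>exp (- z) \<le> 1 - z + z\<^sup>2\<close>, valid for \<open>z \<ge> 0\<close>.\<close>

lemma (in prob_space) laplace_transform_le:
  fixes Z :: "'a \<Rightarrow> real"
  assumes "integrable M Z" "integrable M (\<lambda>x. (Z x)\<^sup>2)" "\<And>x. 0 \<le> Z x"
    and "expectation Z = 1" "expectation (\<lambda>x. (Z x)\<^sup>2) \<le> K" "0 \<le> t"
  shows "(\<integral>\<^sup>+ x. ennreal (exp (- t * Z x)) \<partial>M) \<le> ennreal (exp (- t + K * t\<^sup>2))"
proof -
  have exp_le: "exp (- z) \<le> 1 - z + z\<^sup>2" if "0 \<le> z" for z :: real
  proof -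
    have "exp (- z) \<le> 1 / (1 + z)"
      using that exp_ge_add_one_self[of z] by (simp add: exp_minus field_simps)
    also have "\<dots> \<le> 1 - z + z\<^sup>2"
    proof -
      have "1 \<le> 1 + z ^ 3" using that by simp
      also have "\<dots> = (1 - z + z\<^sup>2) * (1 + z)" by (simp add: algebra_simps power2_eq_square power3_eq_cube)
      finally show ?thesis using that by (simp add: divide_le_eq)
    qed
    finally show ?thesis .
  qed
  have "(\<integral>\<^sup>+ x. ennreal (exp (- t * Z x)) \<partial>M) \<le> (\<integral>\<^sup>+ x. ennreal (1 - t * Z x + t\<^sup>2 * (Z x)\<^sup>2) \<partial>M)"
    using exp_le[of "t * Z _"] assms
    by (intro nn_integral_mono ennreal_leI) (simp add: power_mult_distrib)
  also have "\<dots> = ennreal (expectation (\<lambda>x. 1 - t * Z x + t\<^sup>2 * (Z x)\<^sup>2))"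
  proof (rule nn_integral_eq_integral)
    show "AE x in M. 0 \<le> 1 - t * Z x + t\<^sup>2 * (Z x)\<^sup>2"
    proof (intro always_eventually allI)
      fix x
      have "0 < exp (- (t * Z x))" by simp
      also have "\<dots> \<le> 1 - t * Z x + t\<^sup>2 * (Z x)\<^sup>2"
        using exp_le[of "t * Z x"] assms by (simp add: power_mult_distrib)
      finally show "0 \<le> 1 - t * Z x + t\<^sup>2 * (Z x)\<^sup>2" by simp
    qed
  qed (use assms in simp)
  also have "expectation (\<lambda>x. 1 - t * Z x + t\<^sup>2 * (Z x)\<^sup>2) = 1 - t + t\<^sup>2 * expectation (\<lambda>x. (Z x)\<^sup>2)"
    using assms by (simp add: prob_space)
  also have "\<dots> \<le> 1 + (- t + K * t\<^sup>2)"
    using mult_left_mono[OF assms(5), of "t\<^sup>2"] by (simp add: mult.commute)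
  also have "\<dots> \<le> exp (- t + K * t\<^sup>2)" by (rule exp_ge_add_one_self)
  finally show ?thesis by (simp add: ennreal_leI)
qed

text \<open>Either the sum \<open>S\<close> of the \<open>Z (X n)\<close> reaches half of its mean \<open>N\<close>, and the shrinkage factor is at
  most the first term, or it does not, and the factor is at most \<open>1 \<le> exp (t (N / 2 - S))\<close>. Adding
  the two bounds gives a pointwise estimate whose integral factorizes over the samples. The choice
  \<open>t = 1 / (4 K)\<close> minimizes the exponent \<open>N (- t / 2 + K t\<^sup>2)\<close> that results from the Laplace
  transform bound.\<close>

lemma shrinkage_expectation_le:
  fixes Z :: "'a \<Rightarrow> real"
  assumes "prob_space M"
    and int: "integrable M Z" "integrable M (\<lambda>x. (Z x)\<^sup>2)" and Z0: "\<And>x. 0 \<le> Z x"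
    and E: "(LINT x|M. Z x) = 1" "(LINT x|M. (Z x)\<^sup>2) \<le> K" and K: "0 < K" and A: "0 \<le> A"
  shows "(\<integral>\<^sup>+ X. ennreal (1 / (1 + A * (\<Sum>n<N. Z (X n)))) \<partial>(\<Pi>\<^sub>M n\<in>{..<N::nat}. M))
    \<le> ennreal (1 / (1 + A * (real N / 2)) + exp (- real N / (16 * K)))"
proof -
  interpret prob_space M by fact
  interpret P: product_sigma_finite "\<lambda>_::nat. M" ..
  interpret PP: prob_space "\<Pi>\<^sub>M n\<in>{..<N}. M" by (rule prob_space_PiM) (rule prob_space_axioms)
  have [measurable]: "Z \<in> borel_measurable M" using int by simp
  define t where "t = 1 / (4 * K)"
  have t: "0 \<le> t" using K by (simp add: t_def)
  have "(\<integral>\<^sup>+ X. ennreal (1 / (1 + A * (\<Sum>n<N. Z (X n)))) \<partial>(\<Pi>\<^sub>M n\<in>{..<N}. M))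
     \<le> (\<integral>\<^sup>+ X. ennreal (1 / (1 + A * (real N / 2)))
           + ennreal (exp (t * (real N / 2))) * (\<Prod>n<N. ennreal (exp (- t * Z (X n)))) \<partial>(\<Pi>\<^sub>M n\<in>{..<N}. M))"
  proof (rule nn_integral_mono)
    fix X
    define S where "S = (\<Sum>n<N. Z (X n))"
    have S0: "0 \<le> S" unfolding S_def using Z0 by (intro sum_nonneg) auto
    have prod: "(\<Prod>n<N. exp (- t * Z (X n))) = exp (- t * S)"
      by (simp add: S_def exp_sum[symmetric] sum_distrib_left sum_negf[symmetric])
    have "1 / (1 + A * S) \<le> 1 / (1 + A * (real N / 2)) + exp (t * (real N / 2 - S))"
    proof (cases "real N / 2 \<le> S")
      case True
      then have "1 / (1 + A * S) \<le> 1 / (1 + A * (real N / 2))"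
        using A by (intro divide_left_mono add_left_mono mult_left_mono mult_pos_pos add_pos_nonneg
            mult_nonneg_nonneg S0) auto
      then show ?thesis by (simp add: add_increasing2)
    next
      case False
      have "1 / (1 + A * S) \<le> 1" using A S0 by (simp add: divide_le_eq add_pos_nonneg)
      also have "\<dots> \<le> exp (t * (real N / 2 - S))" using False t by simp
      finally show ?thesis using A by (simp add: add_increasing)
    qed
    also have "exp (t * (real N / 2 - S)) = exp (t * (real N / 2)) * (\<Prod>n<N. exp (- t * Z (X n)))"
      unfolding prod by (simp add: exp_add[symmetric] algebra_simps)
    finally show "ennreal (1 / (1 + A * (\<Sum>n<N. Z (X n)))) \<le> ennreal (1 / (1 + A * (real N / 2)))
           + ennreal (exp (t * (real N / 2))) * (\<Prod>n<N. ennreal (exp (- t * Z (X n))))"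
      using A unfolding S_def[symmetric]
      by (simp add: prod_ennreal prod_nonneg ennreal_mult[symmetric] ennreal_plus[symmetric] ennreal_leI del: ennreal_plus)
  qed
  also have "\<dots> = ennreal (1 / (1 + A * (real N / 2)))
      + ennreal (exp (t * (real N / 2))) * (\<Prod>n<N. \<integral>\<^sup>+ x. ennreal (exp (- t * Z x)) \<partial>M)"
    by (subst nn_integral_add, simp, simp, subst nn_integral_cmult, simp,
        subst P.product_nn_integral_prod) (simp_all add: PP.emeasure_space_1)
  also have "\<dots> \<le> ennreal (1 / (1 + A * (real N / 2)))
      + ennreal (exp (t * (real N / 2))) * (\<Prod>n<N. ennreal (exp (- t + K * t\<^sup>2)))"
    using laplace_transform_le[OF int Z0 E t]
    by (intro add_left_mono mult_left_mono prod_mono_ennreal) auto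
  also have "\<dots> = ennreal (1 / (1 + A * (real N / 2)) + exp (t * (real N / 2)) * exp (- t + K * t\<^sup>2) ^ N)"
    using A by (subst ennreal_plus) (auto simp: ennreal_power ennreal_mult)
  also have "exp (t * (real N / 2)) * exp (- t + K * t\<^sup>2) ^ N = exp (- real N / (16 * K))"
  proof -
    have "t * (real N / 2) + real N * (- t + K * t\<^sup>2) = - real N / (16 * K)"
      using K by (simp add: t_def field_simps power2_eq_square)
    then show ?thesis by (simp add: exp_of_nat_mult[symmetric] exp_add[symmetric])
  qed
  finally show ?thesis .
qed

text \<open>The factor by which the data of coordinate \<open>j\<close> increase the precision of the prior, less one.\<close>

definition snr :: "(nat \<Rightarrow> 'h::real_inner) \<Rightarrow> real \<Rightarrow> (nat \<Rightarrow> real) \<Rightarrow> nat \<Rightarrow> nat \<Rightarrow> (nat \<Rightarrow> 'h) \<Rightarrow> real" where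
  "snr \<phi> \<gamma> \<sigma> N j X = \<gamma> powi (-2) * (\<sigma> j)\<^sup>2 * (\<Sum>n<N. (inner (\<phi> j) (X n))\<^sup>2)"

lemma snr_nonneg: "0 \<le> snr \<phi> \<gamma> \<sigma> N j X"
  by (simp add: snr_def power_int_def sum_nonneg)

text \<open>Apply the previous estimate to \<open>\<langle>\<phi>\<^sub>j, x\<rangle>\<^sup>2\<close> divided by its mean. The kurtosis bound holds for
  all linear functionals at once, hence the rate \<open>c\<close> does not depend on \<open>j\<close>.\<close>

lemma expected_shrinkage_le:
  fixes \<phi> :: "nat \<Rightarrow> 'h::{real_inner,banach,second_countable_topology}"
  assumes tr: "training_distribution \<nu> \<Lambda>" and mom: "moment_assumption \<phi> \<nu> \<Lambda>"
    and nz: "\<And>j. \<phi> j \<noteq> 0"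
  obtains c where "0 < c" "\<And>\<gamma> \<sigma> N j. (\<integral>\<^sup>+ X. ennreal (1 / (1 + snr \<phi> \<gamma> \<sigma> N j X)) \<partial>(\<Pi>\<^sub>M n\<in>{..<N}. \<nu>))
    \<le> ennreal (1 / (1 + \<gamma> powi (-2) * (\<sigma> j)\<^sup>2 * inner (\<phi> j) (\<Lambda> (\<phi> j)) * (real N / 2)) + exp (- c * real N))"
proof -
  obtain K where K: "3 \<le> K"
      "\<And>h. (\<integral>\<^sup>+ x. ennreal (inner h x ^ 4) \<partial>\<nu>) \<le> ennreal (K * (inner h (\<Lambda> h))\<^sup>2)"
    using linear_functional_fourth_moment[OF tr mom] by blast
  have prob: "prob_space \<nu>" and [measurable_cong]: "sets \<nu> = sets borel"
    and cov: "covariance_operator \<nu> \<Lambda>" and pos: "\<And>h. h \<noteq> 0 \<Longrightarrow> 0 < inner h (\<Lambda> h)"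
    using tr by (auto simp: training_distribution_def)
  have "(\<integral>\<^sup>+ X. ennreal (1 / (1 + snr \<phi> \<gamma> \<sigma> N j X)) \<partial>(\<Pi>\<^sub>M n\<in>{..<N}. \<nu>))
    \<le> ennreal (1 / (1 + \<gamma> powi (-2) * (\<sigma> j)\<^sup>2 * inner (\<phi> j) (\<Lambda> (\<phi> j)) * (real N / 2)) + exp (- (1 / (16 * K)) * real N))"
    for \<gamma> \<sigma> N j
  proof -
    define v where "v = inner (\<phi> j) (\<Lambda> (\<phi> j))"
    have v: "0 < v" unfolding v_def by (rule pos[OF nz])
    \<comment> \<open>Normalizing to mean \<open>1\<close> turns the kurtosis bound into \<open>E[Z\<^sup>2] \<le> K\<close>.\<close>
    define Z where "Z x = (inner (\<phi> j) x)\<^sup>2 / v" for x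
    have int2: "integrable \<nu> (\<lambda>x. (inner (\<phi> j) x)\<^sup>2)" and E2: "(LINT x|\<nu>. (inner (\<phi> j) x)\<^sup>2) = v"
      using cov by (auto simp: covariance_operator_def v_def power2_eq_square)
    have int4: "integrable \<nu> (\<lambda>x. inner (\<phi> j) x ^ 4)"
    proof (rule integrableI_nonneg)
      show "(\<integral>\<^sup>+ x. ennreal (inner (\<phi> j) x ^ 4) \<partial>\<nu>) < \<infinity>"
        using K(2)[of "\<phi> j"] by (auto simp: less_top[symmetric] top_unique)
    qed (auto simp: zero_le_even_power)
    have "ennreal (LINT x|\<nu>. inner (\<phi> j) x ^ 4) \<le> ennreal (K * v\<^sup>2)"
      using K(2)[of "\<phi> j"] nn_integral_eq_integral[OF int4] by (simp add: v_def zero_le_even_power)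
    then have E4: "(LINT x|\<nu>. inner (\<phi> j) x ^ 4) \<le> K * v\<^sup>2"
      using K(1) by (subst (asm) ennreal_le_iff) auto
    have Z2: "(Z x)\<^sup>2 = inner (\<phi> j) x ^ 4 / v\<^sup>2" for x
      by (simp add: Z_def power_divide power_mult[symmetric])
    have "(\<integral>\<^sup>+ X. ennreal (1 / (1 + \<gamma> powi (-2) * (\<sigma> j)\<^sup>2 * v * (\<Sum>n<N. Z (X n)))) \<partial>(\<Pi>\<^sub>M n\<in>{..<N}. \<nu>))
      \<le> ennreal (1 / (1 + \<gamma> powi (-2) * (\<sigma> j)\<^sup>2 * v * (real N / 2)) + exp (- real N / (16 * K)))"
    proof (rule shrinkage_expectation_le[OF prob])
      show "integrable \<nu> Z" unfolding Z_def using int2 by simp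
      show "integrable \<nu> (\<lambda>x. (Z x)\<^sup>2)" unfolding Z2 using int4 by simp
      show "(LINT x|\<nu>. Z x) = 1" unfolding Z_def using E2 v by simp
      show "(LINT x|\<nu>. (Z x)\<^sup>2) \<le> K" unfolding Z2 using E4 v by (simp add: divide_le_eq)
      show "0 \<le> \<gamma> powi (-2) * (\<sigma> j)\<^sup>2 * v" using v by (simp add: power_int_def)
    qed (use K v in \<open>auto simp: Z_def\<close>)
    moreover have "\<gamma> powi (-2) * (\<sigma> j)\<^sup>2 * v * (\<Sum>n<N. Z (X n)) = snr \<phi> \<gamma> \<sigma> N j X" for X
      using v by (simp add: snr_def Z_def sum_divide_distrib[symmetric])
    ultimately show ?thesis by (simp add: v_def)
  qed
  then show ?thesis using K(1) by (intro that[of "1 / (16 * K)"]) auto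
qed

section \<open>Test errors as series over the coordinates\<close>

lemma norm_sum_orthonormal:
  assumes "orthonormal_basis \<phi>" "finite A"
  shows "(norm (\<Sum>j\<in>A. a j *\<^sub>R \<phi> j))\<^sup>2 = (\<Sum>j\<in>A. (a j)\<^sup>2)"
proof -
  have ortho: "inner (\<phi> i) (\<phi> j) = (if i = j then 1 else 0)" for i j
    using assms(1) by (simp add: orthonormal_basis_def)
  have "(norm (\<Sum>j\<in>A. a j *\<^sub>R \<phi> j))\<^sup>2 = (\<Sum>i\<in>A. \<Sum>j\<in>A. (a i * a j) * inner (\<phi> i) (\<phi> j))"
    by (simp add: power2_norm_eq_inner inner_sum_left inner_sum_right sum_distrib_left mult_ac inner_commute)
  also have "\<dots> = (\<Sum>i\<in>A. \<Sum>j\<in>A. if i = j then a i * a j else 0)"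
    by (intro sum.cong refl) (simp add: ortho)
  also have "\<dots> = (\<Sum>j\<in>A. (a j)\<^sup>2)"
    using assms(2) by (simp add: power2_eq_square)
  finally show ?thesis .
qed

text \<open>In an incomplete space the series could diverge and its sum would be an arbitrary value;
  completeness enters through Cauchy's criterion.\<close>

lemma orthonormal_series:
  fixes \<phi> :: "nat \<Rightarrow> 'h::{real_inner,banach}"
  assumes \<phi>: "orthonormal_basis \<phi>" and sm: "summable (\<lambda>j. (a j)\<^sup>2)"
  shows "(norm (\<Sum>j. a j *\<^sub>R \<phi> j))\<^sup>2 = (\<Sum>j. (a j)\<^sup>2)"
proof -
  have "summable (\<lambda>j. a j *\<^sub>R \<phi> j)"
    unfolding summable_Cauchy
  proof (intro allI impI)
    fix e :: real assume e: "0 < e"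
    then have "0 < e\<^sup>2" by simp
    then obtain n0 where n0: "\<And>m n. m \<ge> n0 \<Longrightarrow> norm (\<Sum>j=m..<n. (a j)\<^sup>2) < e\<^sup>2"
      using sm unfolding summable_Cauchy by blast
    have "norm (\<Sum>j=m..<n. a j *\<^sub>R \<phi> j) < e" if "m \<ge> n0" for m n
    proof (rule power2_less_imp_less)
      show "(norm (\<Sum>j=m..<n. a j *\<^sub>R \<phi> j))\<^sup>2 < e\<^sup>2"
        using n0[OF that, of n] by (simp add: norm_sum_orthonormal[OF \<phi>])
    qed (use e in simp)
    then show "\<exists>N. \<forall>m\<ge>N. \<forall>n. norm (\<Sum>j=m..<n. a j *\<^sub>R \<phi> j) < e" by blast
  qed
  then have "(\<lambda>n. (norm (\<Sum>j<n. a j *\<^sub>R \<phi> j))\<^sup>2) \<longlonglongrightarrow> (norm (\<Sum>j. a j *\<^sub>R \<phi> j))\<^sup>2"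
    by (intro tendsto_intros summable_LIMSEQ)
  then have "(\<lambda>n. \<Sum>j<n. (a j)\<^sup>2) \<longlonglongrightarrow> (norm (\<Sum>j. a j *\<^sub>R \<phi> j))\<^sup>2"
    by (simp add: norm_sum_orthonormal[OF \<phi>])
  from LIMSEQ_unique[OF this summable_LIMSEQ[OF sm]] show ?thesis .
qed

text \<open>Outside the domain of the operator both sides are infinite.\<close>

lemma diag_sqnorm_le:
  fixes \<phi> :: "nat \<Rightarrow> 'h::{real_inner,banach}"
  assumes \<phi>: "orthonormal_basis \<phi>"
  shows "diag_sqnorm \<phi> t c \<le> (\<Sum>j. ennreal ((t j)\<^sup>2 * (c j)\<^sup>2))"
proof (cases "c \<in> diag_dom t")
  case True
  then have sm: "summable (\<lambda>j. (t j * c j)\<^sup>2)" by (simp add: diag_dom_def power_mult_distrib)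
  have "diag_sqnorm \<phi> t c = ennreal (\<Sum>j. (t j * c j)\<^sup>2)"
    using True orthonormal_series[OF \<phi> sm] by (simp add: diag_sqnorm_def diag_op_def)
  also have "\<dots> = (\<Sum>j. ennreal ((t j * c j)\<^sup>2))"
    using sm by (intro suminf_ennreal2[symmetric]) auto
  finally show ?thesis by (simp add: power_mult_distrib)
next
  case False
  have "(\<Sum>j. ennreal ((t j)\<^sup>2 * (c j)\<^sup>2)) = \<infinity>"
  proof (rule ccontr)
    assume "(\<Sum>j. ennreal ((t j)\<^sup>2 * (c j)\<^sup>2)) \<noteq> \<infinity>"
    then have "summable (\<lambda>j. (t j)\<^sup>2 * (c j)\<^sup>2)"
      by (intro summable_suminf_not_top) auto
    with False show False by (simp add: diag_dom_def)
  qed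
  then show ?thesis by simp
qed

lemma test_variance_nonneg:
  "test_distribution \<phi> \<nu>' \<Lambda>' \<Longrightarrow> 0 \<le> inner (\<phi> j) (\<Lambda>' (\<phi> j))"
  by (auto simp: test_distribution_def intro!: Bochner_Integration.integral_nonneg)

lemma L2_sqnorm_le:
  fixes \<phi> :: "nat \<Rightarrow> 'h::{real_inner,banach}"
  assumes \<phi>: "orthonormal_basis \<phi>" and test: "test_distribution \<phi> \<nu>' \<Lambda>'"
  shows "L2_sqnorm \<phi> \<nu>' t \<le> (\<Sum>j. ennreal (inner (\<phi> j) (\<Lambda>' (\<phi> j)) * (t j)\<^sup>2))"
proof -
  have int: "integrable \<nu>' (\<lambda>c. c j * c j)" "inner (\<phi> j) (\<Lambda>' (\<phi> j)) = (LINT c|\<nu>'. c j * c j)" for j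
    using test by (auto simp: test_distribution_def)
  have [measurable]: "(\<lambda>c. c j) \<in> borel_measurable \<nu>'" for j
    using test by (auto simp: test_distribution_def dest: borel_measurable_integrable)
  have "L2_sqnorm \<phi> \<nu>' t \<le> (\<integral>\<^sup>+ c. (\<Sum>j. ennreal ((t j)\<^sup>2 * (c j)\<^sup>2)) \<partial>\<nu>')"
    unfolding L2_sqnorm_def by (intro nn_integral_mono diag_sqnorm_le \<phi>)
  also have "\<dots> = (\<Sum>j. \<integral>\<^sup>+ c. ennreal ((t j)\<^sup>2 * (c j)\<^sup>2) \<partial>\<nu>')"
    by (rule nn_integral_suminf) simp
  also have "\<dots> = (\<Sum>j. ennreal (inner (\<phi> j) (\<Lambda>' (\<phi> j)) * (t j)\<^sup>2))"
  proof (intro suminf_cong)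
    fix j
    show "(\<integral>\<^sup>+ c. ennreal ((t j)\<^sup>2 * (c j)\<^sup>2) \<partial>\<nu>') = ennreal (inner (\<phi> j) (\<Lambda>' (\<phi> j)) * (t j)\<^sup>2)"
      unfolding int(2) using int(1)[of j]
      by (subst nn_integral_eq_integral) (auto simp: power2_eq_square mult.commute)
  qed
  finally show ?thesis .
qed

lemma prob_space_normal_law: "0 < sd \<Longrightarrow> prob_space (normal_law m sd)"
  unfolding normal_law_def by (rule prob_space_normal_density)

lemma sets_normal_law[measurable_cong, simp]: "sets (normal_law m sd) = sets borel"
  by (simp add: normal_law_def)

lemma nn_integral_normal_law_square:
  assumes "0 < sd"
  shows "(\<integral>\<^sup>+ x. ennreal ((a - x)\<^sup>2) \<partial>normal_law m sd) = ennreal ((a - m)\<^sup>2 + sd\<^sup>2)"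
proof -
  have "has_bochner_integral lborel (\<lambda>x. (a - m)\<^sup>2 * (normal_density m sd x * (x - m) ^ (2 * 0))
      - 2 * (a - m) * (normal_density m sd x * (x - m) ^ (2 * 0 + 1))
      + normal_density m sd x * (x - m) ^ (2 * 1))
      ((a - m)\<^sup>2 * (fact (2 * 0) / ((2 / sd\<^sup>2) ^ 0 * fact 0)) - 2 * (a - m) * 0
        + fact (2 * 1) / ((2 / sd\<^sup>2) ^ 1 * fact 1))"
    using assms by (intro has_bochner_integral_add has_bochner_integral_diff
        has_bochner_integral_mult_right normal_moment_even normal_moment_odd)
  then have hb: "has_bochner_integral lborel (\<lambda>x. normal_density m sd x * (a - x)\<^sup>2) ((a - m)\<^sup>2 + sd\<^sup>2)"
    by (simp add: fact_numeral power2_eq_square algebra_simps)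
  have "(\<integral>\<^sup>+ x. ennreal ((a - x)\<^sup>2) \<partial>normal_law m sd)
      = (\<integral>\<^sup>+ x. ennreal (normal_density m sd x * (a - x)\<^sup>2) \<partial>lborel)"
    unfolding normal_law_def by (subst nn_integral_density) (auto simp: ennreal_mult)
  also have "\<dots> = ennreal ((a - m)\<^sup>2 + sd\<^sup>2)"
    using hb by (subst nn_integral_eq_integral) (auto simp: has_bochner_integral_iff)
  finally show ?thesis .
qed

lemma std_normal_law_moments:
  "integrable (normal_law 0 1) (\<lambda>x. x)" "(LINT x|normal_law 0 1. x) = 0"
  "integrable (normal_law 0 1) (\<lambda>x. x\<^sup>2)" "(LINT x|normal_law 0 1. x\<^sup>2) = 1"
  using normal_moment_odd[of 1 0 0] normal_moment_even[of 1 0 1]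
  by (auto simp: normal_law_def integrable_density integral_density has_bochner_integral_iff fact_numeral)

lemma nn_integral_PiM_component:
  assumes "\<And>i. i \<in> I \<Longrightarrow> prob_space (M i)" "i \<in> I" "f \<in> borel_measurable (M i)"
  shows "(\<integral>\<^sup>+ x. f (x i) \<partial>PiM I M) = (\<integral>\<^sup>+ y. f y \<partial>M i)"
proof -
  have "(\<integral>\<^sup>+ y. f y \<partial>M i) = (\<integral>\<^sup>+ y. f y \<partial>distr (PiM I M) (M i) (\<lambda>x. x i))"
    using assms by (subst distr_PiM_component) auto
  also have "\<dots> = (\<integral>\<^sup>+ x. f (x i) \<partial>PiM I M)"
    using assms by (intro nn_integral_distr) auto
  finally show ?thesis by simp
qed

lemma posterior_expectation_le:
  fixes \<phi> :: "nat \<Rightarrow> 'h::{real_inner,banach}"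
  assumes \<phi>: "orthonormal_basis \<phi>" and test: "test_distribution \<phi> \<nu>' \<Lambda>'"
    and var: "\<And>j. 0 < post_var \<phi> \<gamma> \<sigma> N D j"
  shows "(\<integral>\<^sup>+ l. L2_sqnorm \<phi> \<nu>' (\<lambda>j. ldag j - l j) \<partial>posterior \<phi> \<gamma> \<sigma> N D)
    \<le> (\<Sum>j. ennreal (inner (\<phi> j) (\<Lambda>' (\<phi> j)) *
          ((ldag j - post_mean \<phi> \<gamma> \<sigma> N D j)\<^sup>2 + post_var \<phi> \<gamma> \<sigma> N D j)))"
proof -
  define P where "P = (\<lambda>j. normal_law (post_mean \<phi> \<gamma> \<sigma> N D j) (sqrt (post_var \<phi> \<gamma> \<sigma> N D j)))"
  have post: "posterior \<phi> \<gamma> \<sigma> N D = PiM UNIV P" by (simp add: posterior_def P_def)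
  have [measurable_cong]: "sets (P j) = sets borel" for j by (simp add: P_def)
  have prob: "prob_space (P j)" for j
    unfolding P_def using var by (intro prob_space_normal_law) auto
  have "(\<integral>\<^sup>+ l. L2_sqnorm \<phi> \<nu>' (\<lambda>j. ldag j - l j) \<partial>posterior \<phi> \<gamma> \<sigma> N D)
      \<le> (\<integral>\<^sup>+ l. (\<Sum>j. ennreal (inner (\<phi> j) (\<Lambda>' (\<phi> j)) * (ldag j - l j)\<^sup>2)) \<partial>PiM UNIV P)"
    unfolding post by (intro nn_integral_mono L2_sqnorm_le[OF \<phi> test])
  also have "\<dots> = (\<Sum>j. \<integral>\<^sup>+ l. ennreal (inner (\<phi> j) (\<Lambda>' (\<phi> j)) * (ldag j - l j)\<^sup>2) \<partial>PiM UNIV P)"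
    by (rule nn_integral_suminf) measurable
  also have "\<dots> = (\<Sum>j. ennreal (inner (\<phi> j) (\<Lambda>' (\<phi> j)) *
          ((ldag j - post_mean \<phi> \<gamma> \<sigma> N D j)\<^sup>2 + post_var \<phi> \<gamma> \<sigma> N D j)))"
  proof (intro suminf_cong)
    fix j
    have "(\<integral>\<^sup>+ l. ennreal (inner (\<phi> j) (\<Lambda>' (\<phi> j)) * (ldag j - l j)\<^sup>2) \<partial>PiM UNIV P)
        = (\<integral>\<^sup>+ x. ennreal (inner (\<phi> j) (\<Lambda>' (\<phi> j)) * (ldag j - x)\<^sup>2) \<partial>P j)"
      using prob by (intro nn_integral_PiM_component) auto
    also have "\<dots> = ennreal (inner (\<phi> j) (\<Lambda>' (\<phi> j))) * (\<integral>\<^sup>+ x. ennreal ((ldag j - x)\<^sup>2) \<partial>P j)"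
      using test_variance_nonneg[OF test] by (subst nn_integral_cmult[symmetric]) (auto simp: ennreal_mult)
    also have "(\<integral>\<^sup>+ x. ennreal ((ldag j - x)\<^sup>2) \<partial>P j)
        = ennreal ((ldag j - post_mean \<phi> \<gamma> \<sigma> N D j)\<^sup>2 + post_var \<phi> \<gamma> \<sigma> N D j)"
      unfolding P_def using var[of j] by (subst nn_integral_normal_law_square) (auto simp: less_imp_le)
    also have "ennreal (inner (\<phi> j) (\<Lambda>' (\<phi> j))) * \<dots> = ennreal (inner (\<phi> j) (\<Lambda>' (\<phi> j)) *
          ((ldag j - post_mean \<phi> \<gamma> \<sigma> N D j)\<^sup>2 + post_var \<phi> \<gamma> \<sigma> N D j))"
      using test_variance_nonneg[OF test, of j] var[of j] by (subst ennreal_mult) auto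
    finally show "(\<integral>\<^sup>+ l. ennreal (inner (\<phi> j) (\<Lambda>' (\<phi> j)) * (ldag j - l j)\<^sup>2) \<partial>PiM UNIV P) = \<dots>" .
  qed
  finally show ?thesis .
qed

lemma indep_vars_PiM_components:
  assumes "\<And>i. i \<in> I \<Longrightarrow> prob_space (M i)"
  shows "prob_space.indep_vars (PiM I M) M (\<lambda>i \<omega>. \<omega> i) I"
proof -
  interpret prob_space "PiM I M" by (rule prob_space_PiM) fact
  show ?thesis
  proof (cases "I = {}")
    case True
    then show ?thesis unfolding indep_vars_def indep_sets_def by auto
  next
    case False
    have "distr (PiM I M) (PiM I M) (\<lambda>x. \<lambda>i\<in>I. x i) = distr (PiM I M) (PiM I M) (\<lambda>x. x)"
      by (intro distr_cong) (auto simp: space_PiM)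
    also have "\<dots> = PiM I M" by (simp add: distr_id2)
    also have "\<dots> = (\<Pi>\<^sub>M i\<in>I. distr (PiM I M) (M i) (\<lambda>x. x i))"
      using assms by (intro PiM_cong) (auto simp: distr_PiM_component)
    finally show ?thesis
      using False by (subst indep_vars_iff_distr_eq_PiM') auto
  qed
qed

text \<open>Only the coordinates \<open>(j, n)\<close> with \<open>n < N\<close> occur. They are independent, centred and of unit
  variance, so the cross terms vanish.\<close>

lemma nn_integral_noise:
  fixes b :: "nat \<Rightarrow> real" and j :: nat
  shows "(\<integral>\<^sup>+ \<xi>. ennreal ((a - (\<Sum>n<N. b n * \<xi> (j, n)))\<^sup>2) \<partial>(\<Pi>\<^sub>M jn\<in>UNIV \<times> {..<N}. normal_law 0 1))
    = ennreal (a\<^sup>2 + (\<Sum>n<N. (b n)\<^sup>2))"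
proof -
  let ?I = "UNIV \<times> {..<N} :: (nat \<times> nat) set"
  let ?P = "\<Pi>\<^sub>M jn\<in>?I. normal_law 0 1"
  let ?J = "{j} \<times> {..<N}"
  interpret prob_space ?P by (intro prob_space_PiM prob_space_normal_law) simp
  define X where "X i \<xi> = b (snd i) * \<xi> i" for i and \<xi> :: "nat \<times> nat \<Rightarrow> real"
  have J: "?J \<subseteq> ?I" by auto
  have comp: "distr ?P (normal_law 0 1) (\<lambda>\<xi>. \<xi> i) = normal_law 0 1" if "i \<in> ?J" for i
    using that J by (intro distr_PiM_component prob_space_normal_law) auto
  have coord: "integrable ?P (\<lambda>\<xi>. f (\<xi> i))" "(LINT \<xi>|?P. f (\<xi> i)) = (LINT x|normal_law 0 1. f x)"
    if "i \<in> ?J" "integrable (normal_law 0 1) f" for i and f :: "real \<Rightarrow> real"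
  proof -
    have [measurable]: "(\<lambda>\<xi>. \<xi> i) \<in> measurable ?P (normal_law 0 1)"
      using that J by (intro measurable_component_singleton) auto
    have [measurable]: "f \<in> borel_measurable (normal_law 0 1)" using that by simp
    have "integrable (distr ?P (normal_law 0 1) (\<lambda>\<xi>. \<xi> i)) f" using that comp[OF that(1)] by simp
    then show "integrable ?P (\<lambda>\<xi>. f (\<xi> i))" by (simp add: integrable_distr_eq)
    have "(LINT x|normal_law 0 1. f x) = (LINT x|distr ?P (normal_law 0 1) (\<lambda>\<xi>. \<xi> i). f x)"
      using comp[OF that(1)] by simp
    also have "\<dots> = (LINT \<xi>|?P. f (\<xi> i))" by (intro integral_distr) auto
    finally show "(LINT \<xi>|?P. f (\<xi> i)) = (LINT x|normal_law 0 1. f x)" by simp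
  qed
  have "indep_vars (\<lambda>_. normal_law 0 1) (\<lambda>i \<xi>. \<xi> i) ?I"
    by (rule indep_vars_PiM_components) (rule prob_space_normal_law, simp)
  then have "indep_vars (\<lambda>_. borel) X ?I"
    unfolding X_def by (rule indep_vars_compose2) simp
  then have indep: "indep_vars (\<lambda>_. borel) X ?J" using J by (rule indep_vars_subset)
  have X_eq: "X i = (\<lambda>\<xi>. b (snd i) * \<xi> i)" for i by (simp add: X_def fun_eq_iff)
  have X: "integrable ?P (\<lambda>\<xi>. (X i \<xi>)\<^sup>2)" "expectation (X i) = 0"
      "expectation (\<lambda>\<xi>. (X i \<xi>)\<^sup>2) = (b (snd i))\<^sup>2" if "i \<in> ?J" for i
    using coord[OF that std_normal_law_moments(1)] coord[OF that std_normal_law_moments(3)]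
    by (simp_all add: X_eq power_mult_distrib std_normal_law_moments)
  define S where "S \<xi> = (\<Sum>i\<in>?J. X i \<xi>)" for \<xi>
  have sumJ: "(\<Sum>i\<in>?J. f i) = (\<Sum>n<N. f (j, n))" for f :: "nat \<times> nat \<Rightarrow> real"
    by (rule sum.reindex_bij_witness[of _ "\<lambda>n. (j, n)" snd]) auto
  have fin: "finite ?J" by simp
  have S: "integrable ?P (\<lambda>\<xi>. (S \<xi>)\<^sup>2)" "integrable ?P S" "expectation S = 0"
      "expectation (\<lambda>\<xi>. (S \<xi>)\<^sup>2) = (\<Sum>n<N. (b n)\<^sup>2)"
    using indep_sum_second_moment[OF fin indep X(1,2)] X(3)
    unfolding S_def by (auto simp: sumJ)
  have S_eq: "S \<xi> = (\<Sum>n<N. b n * \<xi> (j, n))" for \<xi> unfolding S_def sumJ by (simp add: X_def)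
  have sq: "(a - S \<xi>)\<^sup>2 = a\<^sup>2 + (S \<xi>)\<^sup>2 - 2 * a * S \<xi>" for \<xi> by (rule power2_diff)
  have "integrable ?P (\<lambda>\<xi>. (a - S \<xi>)\<^sup>2)" unfolding sq using S by simp
  then have "(\<integral>\<^sup>+ \<xi>. ennreal ((a - S \<xi>)\<^sup>2) \<partial>?P) = ennreal (expectation (\<lambda>\<xi>. (a - S \<xi>)\<^sup>2))"
    by (intro nn_integral_eq_integral) auto
  also have "expectation (\<lambda>\<xi>. (a - S \<xi>)\<^sup>2) = a\<^sup>2 + (\<Sum>n<N. (b n)\<^sup>2)"
    unfolding sq using S by (simp add: prob_space)
  finally show ?thesis unfolding S_eq .
qed

lemma post_var_eq_snr:
  assumes "N \<ge> 1"
  shows "post_var \<phi> \<gamma> \<sigma> N (X, Y) j = (\<sigma> j)\<^sup>2 / (1 + snr \<phi> \<gamma> \<sigma> N j X)"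
  using assms by (simp add: post_var_def snr_def)

lemma post_var_pos:
  assumes "N \<ge> 1" "0 < (\<sigma> j)\<^sup>2"
  shows "0 < post_var \<phi> \<gamma> \<sigma> N D j"
proof (cases D)
  case (Pair X Y)
  then show ?thesis
    using assms snr_nonneg[of \<phi> \<gamma> \<sigma> N j X] by (simp add: post_var_eq_snr add_pos_nonneg)
qed

text \<open>The error splits into the shrunken truth, which is the bias, and a linear combination of the
  noise variables.\<close>

lemma post_mean_error_eq:
  assumes "N \<ge> 1" and Y: "\<And>n. n < N \<Longrightarrow> Y (j, n) = inner (\<phi> j) (X n) * l + \<gamma> * \<xi> (j, n)"
  shows "l - post_mean \<phi> \<gamma> \<sigma> N (X, Y) j = l / (1 + snr \<phi> \<gamma> \<sigma> N j X)
    - (\<Sum>n<N. (\<gamma> powi (-2) * (\<sigma> j)\<^sup>2 * \<gamma> * inner (\<phi> j) (X n) / (1 + snr \<phi> \<gamma> \<sigma> N j X)) * \<xi> (j, n))"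
proof -
  define q where "q = \<gamma> powi (-2) * (\<sigma> j)\<^sup>2"
  define A where "A = snr \<phi> \<gamma> \<sigma> N j X"
  define W where "W = (\<Sum>n<N. inner (\<phi> j) (X n) * \<xi> (j, n))"
  have A: "1 + A \<noteq> 0" using snr_nonneg[of \<phi> \<gamma> \<sigma> N j X] by (simp add: A_def)
  have "(\<Sum>n<N. Y (j, n) * inner (\<phi> j) (X n))
      = (\<Sum>n<N. l * (inner (\<phi> j) (X n))\<^sup>2 + \<gamma> * (inner (\<phi> j) (X n) * \<xi> (j, n)))"
    by (intro sum.cong refl) (simp add: Y power2_eq_square algebra_simps)
  also have "\<dots> = l * (\<Sum>n<N. (inner (\<phi> j) (X n))\<^sup>2) + \<gamma> * W"
    by (simp add: sum.distrib W_def sum_distrib_left)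
  finally have YX: "(\<Sum>n<N. Y (j, n) * inner (\<phi> j) (X n)) = \<dots>" .
  have "post_mean \<phi> \<gamma> \<sigma> N (X, Y) j = (q * (l * (\<Sum>n<N. (inner (\<phi> j) (X n))\<^sup>2) + \<gamma> * W)) / (1 + A)"
    using assms(1) by (simp add: post_mean_def YX A_def snr_def q_def mult.assoc)
  also have "q * (l * (\<Sum>n<N. (inner (\<phi> j) (X n))\<^sup>2) + \<gamma> * W) = l * A + q * \<gamma> * W"
    by (simp add: A_def snr_def q_def algebra_simps)
  finally have "l - post_mean \<phi> \<gamma> \<sigma> N (X, Y) j = (l * (1 + A) - (l * A + q * \<gamma> * W)) / (1 + A)"
    using A by (simp add: diff_divide_distrib)
  also have "\<dots> = l / (1 + A) - q * \<gamma> / (1 + A) * W"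
    by (simp add: algebra_simps diff_divide_distrib)
  also have "q * \<gamma> / (1 + A) * W = (\<Sum>n<N. (q * \<gamma> * inner (\<phi> j) (X n) / (1 + A)) * \<xi> (j, n))"
    by (simp add: W_def sum_distrib_left mult_ac)
  finally show ?thesis by (simp add: q_def A_def)
qed

text \<open>The bias contributes \<open>l\<^sup>2 / (1 + A)\<^sup>2\<close> and the noise \<open>\<sigma>\<^sub>j\<^sup>2 A / (1 + A)\<^sup>2\<close>; since \<open>A \<ge> 0\<close>, in each
  of them one factor \<open>1 + A\<close> of the denominator can be dropped or cancelled against the numerator.\<close>

lemma noise_average_le:
  assumes N: "N \<ge> 1" and \<gamma>: "\<gamma> > 0" and l: "l = ldag j"
  shows "(\<integral>\<^sup>+ \<xi>. ennreal ((l - post_mean \<phi> \<gamma> \<sigma> N (X, \<lambda>(j, n)\<in>UNIV \<times> {..<N}. inner (\<phi> j) (X n) * ldag j + \<gamma> * \<xi> (j, n)) j)\<^sup>2)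
      \<partial>(\<Pi>\<^sub>M jn\<in>UNIV \<times> {..<N}. normal_law 0 1))
    \<le> ennreal ((l\<^sup>2 + (\<sigma> j)\<^sup>2) / (1 + snr \<phi> \<gamma> \<sigma> N j X))"
proof -
  define A where "A = snr \<phi> \<gamma> \<sigma> N j X"
  define q where "q = \<gamma> powi (-2) * (\<sigma> j)\<^sup>2 * \<gamma>"
  have A: "0 \<le> A" by (simp add: A_def snr_nonneg)
  have le: "x / (1 + A)\<^sup>2 \<le> x / (1 + A)" if "0 \<le> x" for x
    using that A by (intro divide_left_mono) (auto simp: power2_eq_square mult_le_cancel_left1)
  have "(\<Sum>n<N. (q * inner (\<phi> j) (X n) / (1 + A))\<^sup>2) = q\<^sup>2 * (\<Sum>n<N. (inner (\<phi> j) (X n))\<^sup>2) / (1 + A)\<^sup>2"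
    by (simp add: power_mult_distrib power_divide sum_distrib_left sum_divide_distrib)
  also have "q\<^sup>2 * (\<Sum>n<N. (inner (\<phi> j) (X n))\<^sup>2) = (\<sigma> j)\<^sup>2 * A"
    using \<gamma> by (simp add: q_def A_def snr_def power_int_minus power2_eq_square field_simps)
  also have "(\<sigma> j)\<^sup>2 * A / (1 + A)\<^sup>2 \<le> (\<sigma> j)\<^sup>2 * (1 + A) / (1 + A)\<^sup>2"
    using A by (intro divide_right_mono mult_left_mono) auto
  also have "\<dots> = (\<sigma> j)\<^sup>2 / (1 + A)"
    using A by (simp add: power2_eq_square)
  finally have noise: "(\<Sum>n<N. (q * inner (\<phi> j) (X n) / (1 + A))\<^sup>2) \<le> (\<sigma> j)\<^sup>2 / (1 + A)" .
  have "(\<integral>\<^sup>+ \<xi>. ennreal ((l - post_mean \<phi> \<gamma> \<sigma> N (X, \<lambda>(j, n)\<in>UNIV \<times> {..<N}. inner (\<phi> j) (X n) * ldag j + \<gamma> * \<xi> (j, n)) j)\<^sup>2)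
      \<partial>(\<Pi>\<^sub>M jn\<in>UNIV \<times> {..<N}. normal_law 0 1))
    = (\<integral>\<^sup>+ \<xi>. ennreal ((l / (1 + A) - (\<Sum>n<N. (q * inner (\<phi> j) (X n) / (1 + A)) * \<xi> (j, n)))\<^sup>2)
      \<partial>(\<Pi>\<^sub>M jn\<in>UNIV \<times> {..<N}. normal_law 0 1))"
  proof (rule nn_integral_cong)
    fix \<xi> :: "nat \<times> nat \<Rightarrow> real"
    show "ennreal ((l - post_mean \<phi> \<gamma> \<sigma> N (X, \<lambda>(j, n)\<in>UNIV \<times> {..<N}. inner (\<phi> j) (X n) * ldag j + \<gamma> * \<xi> (j, n)) j)\<^sup>2)
      = ennreal ((l / (1 + A) - (\<Sum>n<N. (q * inner (\<phi> j) (X n) / (1 + A)) * \<xi> (j, n)))\<^sup>2)"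
      unfolding A_def q_def using N l
      by (intro arg_cong[where f = "\<lambda>x. ennreal (x\<^sup>2)"] post_mean_error_eq) auto
  qed
  also have "\<dots> = ennreal ((l / (1 + A))\<^sup>2 + (\<Sum>n<N. (q * inner (\<phi> j) (X n) / (1 + A))\<^sup>2))"
    by (rule nn_integral_noise)
  also have "\<dots> \<le> ennreal (l\<^sup>2 / (1 + A) + (\<sigma> j)\<^sup>2 / (1 + A))"
    using noise le[of "l\<^sup>2"] by (intro ennreal_leI add_mono) (auto simp: power_divide)
  finally show ?thesis by (simp add: A_def add_divide_distrib)
qed

text \<open>The contribution of coordinate \<open>j\<close> to the test error of a posterior draw. It dominates the
  contribution to the error of the posterior mean as well, so both errors can be treated at once.\<close>

definition risk :: "(nat \<Rightarrow> 'h::real_inner) \<Rightarrow> real \<Rightarrow> (nat \<Rightarrow> real) \<Rightarrow> ('h \<Rightarrow> 'h) \<Rightarrow> (nat \<Rightarrow> real) \<Rightarrow> nat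
    \<Rightarrow> 'h data \<Rightarrow> nat \<Rightarrow> real" where
  "risk \<phi> \<gamma> \<sigma> \<Lambda>' l N D j =
     inner (\<phi> j) (\<Lambda>' (\<phi> j)) * ((l j - post_mean \<phi> \<gamma> \<sigma> N D j)\<^sup>2 + post_var \<phi> \<gamma> \<sigma> N D j)"

lemma post_mean_measurable:
  fixes \<phi> :: "nat \<Rightarrow> 'h::{real_inner,banach,second_countable_topology}"
  shows "(\<lambda>D. post_mean \<phi> \<gamma> \<sigma> N D j) \<in> borel_measurable (data_space N)"
  unfolding post_mean_def data_space_def split_beta by measurable

lemma post_var_measurable:
  fixes \<phi> :: "nat \<Rightarrow> 'h::{real_inner,banach,second_countable_topology}"
  shows "(\<lambda>D. post_var \<phi> \<gamma> \<sigma> N D j) \<in> borel_measurable (data_space N)"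
  unfolding post_var_def data_space_def split_beta by measurable

lemma data_map_measurable:
  fixes \<phi> :: "nat \<Rightarrow> 'h::{real_inner,banach,second_countable_topology}"
  assumes [measurable_cong]: "sets \<nu> = sets borel"
  shows "(\<lambda>(X, \<xi>). (X, \<lambda>(j, n)\<in>UNIV \<times> {..<N}. inner (\<phi> j) (X n) * l j + \<gamma> * \<xi> (j, n)))
    \<in> (\<Pi>\<^sub>M n\<in>{..<N}. \<nu>) \<Otimes>\<^sub>M (\<Pi>\<^sub>M jn\<in>UNIV \<times> {..<N}. normal_law 0 1) \<rightarrow>\<^sub>M data_space N"
  unfolding data_space_def split_beta
proof (intro measurable_Pair measurable_restrict)
  fix i :: "nat \<times> nat" assume i: "i \<in> UNIV \<times> {..<N}"
  then have [measurable]: "(\<lambda>x. fst x (snd i)) \<in> measurable ((\<Pi>\<^sub>M n\<in>{..<N}. \<nu>) \<Otimes>\<^sub>M (\<Pi>\<^sub>M jn\<in>UNIV \<times> {..<N}. normal_law 0 1)) borel"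
    "(\<lambda>x. snd x (fst i, snd i)) \<in> measurable ((\<Pi>\<^sub>M n\<in>{..<N}. \<nu>) \<Otimes>\<^sub>M (\<Pi>\<^sub>M jn\<in>UNIV \<times> {..<N}. normal_law 0 1)) borel"
    by (auto intro!: measurable_compose[OF measurable_fst measurable_component_singleton[THEN measurable_compose]]) 
  show "(\<lambda>x. inner (\<phi> (fst i)) (fst x (snd i)) * l (fst i) + \<gamma> * snd x (fst i, snd i))
      \<in> borel_measurable ((\<Pi>\<^sub>M n\<in>{..<N}. \<nu>) \<Otimes>\<^sub>M (\<Pi>\<^sub>M jn\<in>UNIV \<times> {..<N}. normal_law 0 1))"
    by measurable
next
  show "fst \<in> (\<Pi>\<^sub>M n\<in>{..<N}. \<nu>) \<Otimes>\<^sub>M (\<Pi>\<^sub>M jn\<in>UNIV \<times> {..<N}. normal_law 0 1) \<rightarrow>\<^sub>M (\<Pi>\<^sub>M n\<in>{..<N}. borel)"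
    by measurable
qed

text \<open>Integrate first over the noise and then over the inputs.\<close>

lemma risk_expectation_le:
  fixes \<phi> :: "nat \<Rightarrow> 'h::{real_inner,banach,second_countable_topology}"
  assumes \<nu>: "prob_space \<nu>" and sets[measurable_cong]: "sets \<nu> = sets borel"
    and test: "test_distribution \<phi> \<nu>' \<Lambda>'"
    and N: "N \<ge> 1" and \<gamma>: "\<gamma> > 0"
  shows "(\<integral>\<^sup>+ D. ennreal (risk \<phi> \<gamma> \<sigma> \<Lambda>' l N D j) \<partial>data_law \<phi> \<gamma> \<nu> l N)
    \<le> ennreal (inner (\<phi> j) (\<Lambda>' (\<phi> j)) * ((l j)\<^sup>2 + 2 * (\<sigma> j)\<^sup>2)) *
        (\<integral>\<^sup>+ X. ennreal (1 / (1 + snr \<phi> \<gamma> \<sigma> N j X)) \<partial>(\<Pi>\<^sub>M n\<in>{..<N}. \<nu>))"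
proof -
  let ?X = "\<Pi>\<^sub>M n\<in>{..<N}. \<nu>" and ?\<Xi> = "\<Pi>\<^sub>M jn\<in>UNIV \<times> {..<N}. normal_law 0 1"
  define T where "T X \<xi> = (X, \<lambda>(j, n)\<in>UNIV \<times> {..<N}. inner (\<phi> j) (X n) * l j + \<gamma> * \<xi> (j, n))"
    for X :: "nat \<Rightarrow> 'h" and \<xi> :: "nat \<times> nat \<Rightarrow> real"
  define \<theta> where "\<theta> = inner (\<phi> j) (\<Lambda>' (\<phi> j))"
  have \<theta>: "0 \<le> \<theta>" unfolding \<theta>_def by (rule test_variance_nonneg[OF test])
  interpret \<Xi>: prob_space ?\<Xi> by (intro prob_space_PiM prob_space_normal_law) simp
  interpret X: prob_space ?X by (intro prob_space_PiM \<nu>)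
  note [measurable] = post_mean_measurable post_var_measurable
  have Tm[measurable]: "(\<lambda>(X, \<xi>). T X \<xi>) \<in> ?X \<Otimes>\<^sub>M ?\<Xi> \<rightarrow>\<^sub>M data_space N"
    unfolding T_def by (rule data_map_measurable[OF sets])
  have rm[measurable]: "(\<lambda>D. risk \<phi> \<gamma> \<sigma> \<Lambda>' l N D j) \<in> borel_measurable (data_space N)"
    unfolding risk_def by measurable
  have sm[measurable]: "(\<lambda>X. snr \<phi> \<gamma> \<sigma> N j X) \<in> borel_measurable ?X"
    unfolding snr_def by measurable
  have "(\<integral>\<^sup>+ D. ennreal (risk \<phi> \<gamma> \<sigma> \<Lambda>' l N D j) \<partial>data_law \<phi> \<gamma> \<nu> l N)
      = (\<integral>\<^sup>+ z. ennreal (risk \<phi> \<gamma> \<sigma> \<Lambda>' l N (case z of (X, \<xi>) \<Rightarrow> T X \<xi>) j) \<partial>(?X \<Otimes>\<^sub>M ?\<Xi>))"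
    unfolding data_law_def T_def[symmetric] using Tm by (subst nn_integral_distr) auto
  also have "\<dots> = (\<integral>\<^sup>+ X. \<integral>\<^sup>+ \<xi>. ennreal (risk \<phi> \<gamma> \<sigma> \<Lambda>' l N (T X \<xi>) j) \<partial>?\<Xi> \<partial>?X)"
    by (subst \<Xi>.nn_integral_fst[symmetric]) auto
  also have "\<dots> \<le> (\<integral>\<^sup>+ X. ennreal (\<theta> * ((l j)\<^sup>2 + 2 * (\<sigma> j)\<^sup>2)) * ennreal (1 / (1 + snr \<phi> \<gamma> \<sigma> N j X)) \<partial>?X)"
  proof (rule nn_integral_mono)
    fix X assume X: "X \<in> space ?X"
    define A where "A = snr \<phi> \<gamma> \<sigma> N j X"
    have A: "0 \<le> A" by (simp add: A_def snr_nonneg)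
    have [measurable]: "(\<lambda>\<xi>. T X \<xi>) \<in> ?\<Xi> \<rightarrow>\<^sub>M data_space N"
      using measurable_compose[OF measurable_Pair1'[OF X] Tm] by simp
    have "(\<integral>\<^sup>+ \<xi>. ennreal (risk \<phi> \<gamma> \<sigma> \<Lambda>' l N (T X \<xi>) j) \<partial>?\<Xi>)
        = (\<integral>\<^sup>+ \<xi>. ennreal \<theta> * (ennreal ((l j - post_mean \<phi> \<gamma> \<sigma> N (T X \<xi>) j)\<^sup>2) + ennreal ((\<sigma> j)\<^sup>2 / (1 + A))) \<partial>?\<Xi>)"
      using \<theta> A post_var_eq_snr[OF N, of \<phi> \<gamma> \<sigma> X _ j] unfolding risk_def \<theta>_def[symmetric]
      by (intro nn_integral_cong) (simp add: T_def A_def ennreal_mult)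
    also have "\<dots> = ennreal \<theta> * ((\<integral>\<^sup>+ \<xi>. ennreal ((l j - post_mean \<phi> \<gamma> \<sigma> N (T X \<xi>) j)\<^sup>2) \<partial>?\<Xi>) + ennreal ((\<sigma> j)\<^sup>2 / (1 + A)))"
      by (simp add: nn_integral_cmult nn_integral_add \<Xi>.emeasure_space_1)
    also have "\<dots> \<le> ennreal \<theta> * (ennreal (((l j)\<^sup>2 + (\<sigma> j)\<^sup>2) / (1 + A)) + ennreal ((\<sigma> j)\<^sup>2 / (1 + A)))"
      unfolding T_def A_def by (intro mult_left_mono add_right_mono noise_average_le[OF N \<gamma>]) auto
    also have "\<dots> = ennreal (\<theta> * ((l j)\<^sup>2 + 2 * (\<sigma> j)\<^sup>2)) * ennreal (1 / (1 + A))"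
      using \<theta> A by (simp add: ennreal_plus[symmetric] ennreal_mult[symmetric] add_divide_distrib[symmetric] algebra_simps
          del: ennreal_plus)
    finally show "(\<integral>\<^sup>+ \<xi>. ennreal (risk \<phi> \<gamma> \<sigma> \<Lambda>' l N (T X \<xi>) j) \<partial>?\<Xi>)
      \<le> ennreal (\<theta> * ((l j)\<^sup>2 + 2 * (\<sigma> j)\<^sup>2)) * ennreal (1 / (1 + snr \<phi> \<gamma> \<sigma> N j X))"
      unfolding A_def .
  qed
  also have "\<dots> = ennreal (\<theta> * ((l j)\<^sup>2 + 2 * (\<sigma> j)\<^sup>2)) * (\<integral>\<^sup>+ X. ennreal (1 / (1 + snr \<phi> \<gamma> \<sigma> N j X)) \<partial>?X)"
    by (rule nn_integral_cmult) measurable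
  finally show ?thesis unfolding \<theta>_def .
qed

lemma test_errors_le:
  fixes \<phi> :: "nat \<Rightarrow> 'h::{real_inner,banach,second_countable_topology}" and l :: "nat \<Rightarrow> real"
  assumes \<phi>: "orthonormal_basis \<phi>" and \<nu>: "prob_space \<nu>" "sets \<nu> = sets borel"
    and test: "test_distribution \<phi> \<nu>' \<Lambda>'" and \<sigma>: "\<And>j. 0 < (\<sigma> j)\<^sup>2"
    and N: "N \<ge> 1" and \<gamma>: "\<gamma> > 0"
  defines "B \<equiv> (\<Sum>j. ennreal (inner (\<phi> j) (\<Lambda>' (\<phi> j)) * ((l j)\<^sup>2 + 2 * (\<sigma> j)\<^sup>2)) *
        (\<integral>\<^sup>+ X. ennreal (1 / (1 + snr \<phi> \<gamma> \<sigma> N j X)) \<partial>(\<Pi>\<^sub>M n\<in>{..<N}. \<nu>)))"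
  shows "posterior_test_error \<phi> \<gamma> \<sigma> \<nu> \<nu>' l N \<le> B" "mean_test_error \<phi> \<gamma> \<sigma> \<nu> \<nu>' l N \<le> B"
proof -
  note [measurable] = post_mean_measurable post_var_measurable
  have pv: "0 < post_var \<phi> \<gamma> \<sigma> N D j" for D j by (rule post_var_pos[OF N \<sigma>])
  have [measurable_cong]: "sets (data_law \<phi> \<gamma> \<nu> l N) = sets (data_space N)" by (simp add: data_law_def)
  have rm: "(\<lambda>D. risk \<phi> \<gamma> \<sigma> \<Lambda>' l N D j) \<in> borel_measurable (data_law \<phi> \<gamma> \<nu> l N)" for j
    unfolding risk_def by measurable
  have "(\<integral>\<^sup>+ D. (\<Sum>j. ennreal (risk \<phi> \<gamma> \<sigma> \<Lambda>' l N D j)) \<partial>data_law \<phi> \<gamma> \<nu> l N)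
      = (\<Sum>j. \<integral>\<^sup>+ D. ennreal (risk \<phi> \<gamma> \<sigma> \<Lambda>' l N D j) \<partial>data_law \<phi> \<gamma> \<nu> l N)"
    using rm by (intro nn_integral_suminf) simp
  also have "\<dots> \<le> B"
    unfolding B_def by (intro suminf_le risk_expectation_le[OF \<nu> test N \<gamma>]) auto
  finally have *: "(\<integral>\<^sup>+ D. (\<Sum>j. ennreal (risk \<phi> \<gamma> \<sigma> \<Lambda>' l N D j)) \<partial>data_law \<phi> \<gamma> \<nu> l N) \<le> B" .
  have "posterior_test_error \<phi> \<gamma> \<sigma> \<nu> \<nu>' l N
      \<le> (\<integral>\<^sup>+ D. (\<Sum>j. ennreal (risk \<phi> \<gamma> \<sigma> \<Lambda>' l N D j)) \<partial>data_law \<phi> \<gamma> \<nu> l N)"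
    unfolding posterior_test_error_def risk_def
    by (intro nn_integral_mono posterior_expectation_le[OF \<phi> test] pv)
  with * show "posterior_test_error \<phi> \<gamma> \<sigma> \<nu> \<nu>' l N \<le> B" by simp
  have "mean_test_error \<phi> \<gamma> \<sigma> \<nu> \<nu>' l N
      \<le> (\<integral>\<^sup>+ D. (\<Sum>j. ennreal (risk \<phi> \<gamma> \<sigma> \<Lambda>' l N D j)) \<partial>data_law \<phi> \<gamma> \<nu> l N)"
    unfolding mean_test_error_def risk_def
    using pv test_variance_nonneg[OF test]
    by (intro nn_integral_mono order_trans[OF L2_sqnorm_le[OF \<phi> test]] suminf_le ennreal_leI mult_left_mono)
      (auto simp: less_imp_le)
  with * show "mean_test_error \<phi> \<gamma> \<sigma> \<nu> \<nu>' l N \<le> B" by simp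
qed

section \<open>Convergence rates\<close>

lemma is_bigoI:
  assumes le: "\<forall>\<^sub>F N in sequentially. f N \<le> ennreal (a N)" and a: "a \<in> O(b)"
  shows "is_bigo f b"
  unfolding is_bigo_def
proof (intro exI conjI allI)
  show "0 \<le> enn2real (f N)" for N by simp
  show "\<forall>\<^sub>F N in sequentially. f N = ennreal (enn2real (f N))"
    using le by eventually_elim (auto simp: ennreal_enn2real_if top_unique)
  have "(\<lambda>N. enn2real (f N)) \<in> O(a)"
  proof (rule bigoI[where c = 1])
    show "\<forall>\<^sub>F N in sequentially. norm (enn2real (f N)) \<le> 1 * norm (a N)"
      using le
    proof eventually_elim
      case (elim N)
      then have "f N \<le> ennreal \<bar>a N\<bar>" by (rule order_trans) (intro ennreal_leI abs_ge_self)
      then have "enn2real (f N) \<le> \<bar>a N\<bar>" by (rule enn2real_leI[rotated]) simp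
      then show ?case by simp
    qed
  qed
  then show "(\<lambda>N. enn2real (f N)) \<in> O(b)" using a by (rule landau_o.big_trans)
qed

text \<open>The notion asks for an exact decomposition, whereas estimates only provide an upper bound. The
  \<open>O\<close> part is taken to be the minimum of the error and of its bound, and the \<open>o\<close> part is the rest.\<close>

lemma is_bigo_plus_smalloI:
  assumes le: "\<forall>\<^sub>F N in sequentially. f N \<le> ennreal (a N + c N)" and a: "a \<in> O(b)" and c: "c \<in> o(r)"
  shows "is_bigo_plus_smallo f b r"
proof -
  define h where "h N = enn2real (f N)" for N
  define a' where "a' N = min (h N) \<bar>a N\<bar>" for N
  have h: "0 \<le> h N" for N by (simp add: h_def)
  have "a' \<in> O(a)"
    by (rule bigoI[where c = 1]) (use h in \<open>auto simp: a'_def\<close>)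
  then have 1: "a' \<in> O(b)" using a by (rule landau_o.big_trans)
  have "(\<lambda>N. h N - a' N) \<in> O(c)"
  proof (rule bigoI[where c = 1])
    show "\<forall>\<^sub>F N in sequentially. norm (h N - a' N) \<le> 1 * norm (c N)"
      using le
    proof eventually_elim
      case (elim N)
      have "a N + c N \<le> \<bar>a N\<bar> + \<bar>c N\<bar>" by (intro add_mono abs_ge_self)
      then have "f N \<le> ennreal (\<bar>a N\<bar> + \<bar>c N\<bar>)" using elim by (meson ennreal_leI order_trans)
      then have "h N \<le> \<bar>a N\<bar> + \<bar>c N\<bar>" unfolding h_def by (rule enn2real_leI[rotated]) simp
      then show ?case by (auto simp: a'_def)
    qed
  qed
  then have 2: "(\<lambda>N. h N - a' N) \<in> o(r)" using c by (rule landau_o.big_small_trans)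
  have 3: "\<forall>\<^sub>F N in sequentially. f N = ennreal (a' N + (h N - a' N))"
    using le by eventually_elim (auto simp: h_def ennreal_enn2real_if top_unique)
  show ?thesis
    unfolding is_bigo_plus_smallo_def
    by (intro exI[of _ a'] exI[of _ "\<lambda>N. h N - a' N"] conjI 1 2 3) (use h in \<open>auto simp: a'_def\<close>)
qed

text \<open>On sequences with positive comparison function the estimate holds for all indices, since the
  finitely many exceptional quotients are bounded.\<close>

lemma bigo_imp_bounded_by:
  fixes f g :: "nat \<Rightarrow> real"
  assumes "f \<in> O(g)" "\<And>j. 0 < g j"
  obtains C where "0 < C" "\<And>j. \<bar>f j\<bar> \<le> C * g j"
proof -
  obtain c where "\<forall>\<^sub>F j in sequentially. norm (f j) \<le> c * norm (g j)"
    using assms(1) by (elim landau_o.bigE)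
  then have "\<forall>\<^sub>F j in sequentially. norm (f j / g j) \<le> c"
  proof eventually_elim
    case (elim j)
    then show ?case using assms(2)[of j] by (simp add: divide_le_eq)
  qed
  then have "Bseq (\<lambda>j. f j / g j)" by (rule BfunI)
  then obtain C where C: "0 < C" "\<And>j. norm (f j / g j) \<le> C" by (auto simp: Bseq_def)
  have "\<bar>f j\<bar> \<le> C * g j" for j
    using C(2)[of j] assms(2)[of j] by (simp add: divide_le_eq)
  with C(1) show ?thesis by (rule that)
qed

text \<open>The three summands are the bias, the variance and what remains of the exponentially small
  probability of a poorly excited coordinate.\<close>

definition error_bound :: "real \<Rightarrow> real \<Rightarrow> real \<Rightarrow> real \<Rightarrow> (nat \<Rightarrow> real) \<Rightarrow> nat \<Rightarrow> real" where
  "error_bound \<kappa> r b s l N =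
     (\<Sum>j. real (Suc j) powr (2 * s) * \<bar>l j\<bar>\<^sup>2 * (real (Suc j) powr (- 2 * \<kappa> * r) * shrink \<kappa> N j))
     + (\<Sum>j. real (Suc j) powr (- b) * shrink \<kappa> N j)
     + ((\<Sum>j. real (Suc j) powr (2 * s) * \<bar>l j\<bar>\<^sup>2) + (\<Sum>j. real (Suc j) powr (- b))) / real N"

text \<open>Expand the product and drop the factor \<open>j\<^sup>-\<^sup>2\<^sup>\<kappa>\<^sup>r \<le> 1\<close> in the terms that carry \<open>1 / N\<close>.\<close>

lemma series_le_error_bound:
  fixes T :: "nat \<Rightarrow> real"
  assumes l: "l \<in> Hs s" and N: "N \<ge> 1" and \<kappa>: "0 \<le> \<kappa>" and r: "0 < r" and b: "1 < b"
    and M: "0 \<le> M"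
    and T: "\<And>j. 0 \<le> T j" "\<And>j. T j \<le> M * (real (Suc j) powr (2 * s) * \<bar>l j\<bar>\<^sup>2 * real (Suc j) powr (- 2 * \<kappa> * r)
        + real (Suc j) powr (- b)) * (shrink \<kappa> N j + 1 / real N)"
  shows "(\<Sum>j. ennreal (T j)) \<le> ennreal (M * error_bound \<kappa> r b s l N)"
proof -
  define w where "w j = real (Suc j) powr (2 * s) * \<bar>l j\<bar>\<^sup>2" for j
  have w: "summable w" "\<And>j. 0 \<le> w j" using l unfolding Hs_def w_def[abs_def] by auto
  let ?x = "\<lambda>j. real (Suc j) powr (- 2 * \<kappa> * r)" and ?y = "\<lambda>j. real (Suc j) powr (- b)"
  have s1: "summable (\<lambda>j. w j * (?x j * shrink \<kappa> N j))" using bias_sum_le(1)[OF w r \<kappa> N] .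
  have s2: "summable (\<lambda>j. ?y j * shrink \<kappa> N j)" using summable_powr_mult_shrink[OF b] .
  have s3: "summable ?y" using powr_tail_sum(1)[OF b order_refl] .
  define U where "U j = M * (w j * (?x j * shrink \<kappa> N j) + ?y j * shrink \<kappa> N j + (w j + ?y j) / real N)" for j
  have TU: "T j \<le> U j" for j
  proof -
    have "0 \<le> \<kappa> * r" using \<kappa> r by simp
    then have "?x j \<le> real (Suc j) powr 0" by (intro powr_mono) auto
    then have "w j * ?x j \<le> w j" using w(2)[of j] by (simp add: mult_left_le)
    then have "(w j * ?x j) / real N \<le> w j / real N" by (rule divide_right_mono) simp
    then have "M * ((w j * ?x j + ?y j) * (shrink \<kappa> N j + 1 / real N))
      \<le> M * (w j * (?x j * shrink \<kappa> N j) + ?y j * shrink \<kappa> N j + (w j + ?y j) / real N)"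
      using M by (intro mult_left_mono) (auto simp: distrib_left distrib_right add_divide_distrib)
    then show ?thesis using T(2)[of j] by (simp add: U_def w_def mult.assoc)
  qed
  have sU: "U sums (M * error_bound \<kappa> r b s l N)"
    unfolding U_def error_bound_def w_def[symmetric]
    by (intro sums_mult sums_add sums_divide summable_sums s1 s2 s3 w(1))
  have "(\<Sum>j. ennreal (T j)) \<le> (\<Sum>j. ennreal (U j))"
    using TU by (intro suminf_le ennreal_leI) auto
  also have "\<dots> = ennreal (\<Sum>j. U j)"
    using order_trans[OF T(1) TU] sU by (intro suminf_ennreal2) (auto simp: sums_iff)
  finally show ?thesis using sU by (simp add: sums_iff)
qed

text \<open>Stated for an arbitrary error functional, because it is used for the posterior error and
  for the error of the posterior mean. For a fixed truth the bias belongs to the \<open>o\<close> part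
  if \<open>(\<alpha>' + s) / (\<alpha> + p) < 1\<close> and is absorbed into \<open>O(\<rho>)\<close> otherwise.\<close>

lemma rates_of_error_bound:
  fixes f :: "(nat \<Rightarrow> real) \<Rightarrow> nat \<Rightarrow> ennreal"
  assumes \<kappa>: "0 < \<alpha> + p" and b: "1/2 < \<alpha>' + p" and r: "0 < \<alpha>' + s" and M: "0 \<le> M"
    and le: "\<And>l N. l \<in> Hs s \<Longrightarrow> N \<ge> 1 \<Longrightarrow>
      f l N \<le> ennreal (M * error_bound (\<alpha> + p) ((\<alpha>' + s) / (\<alpha> + p)) (2 * (\<alpha>' + p)) s l N)"
  shows "ldag \<in> Hs s \<Longrightarrow> is_bigo_plus_smallo (f ldag) (\<rho> \<alpha> \<alpha>' p) (\<lambda>N. real N powr (- ((\<alpha>' + s) / (\<alpha> + p))))"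
    and "is_bigo (\<lambda>N. SUP l \<in> {l \<in> Hs s. Hs_norm s l \<le> R}. f l N)
             (\<lambda>N. \<rho> \<alpha> \<alpha>' p N + real N powr (- ((\<alpha>' + s) / (\<alpha> + p))))"
proof -
  define q where "q = (\<alpha>' + s) / (\<alpha> + p)"
  have q: "0 < q" using \<kappa> r by (simp add: q_def)
  define bias where "bias l N = (\<Sum>j. real (Suc j) powr (2 * s) * \<bar>l j\<bar>\<^sup>2 *
      (real (Suc j) powr (- 2 * (\<alpha> + p) * q) * shrink (\<alpha> + p) N j))" for l N
  define var where "var N = (\<Sum>j. real (Suc j) powr (- (2 * (\<alpha>' + p))) * shrink (\<alpha> + p) N j)" for N
  define W where "W l = (\<Sum>j. real (Suc j) powr (2 * s) * \<bar>l j\<bar>\<^sup>2)" for l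
  define V where "V = (\<Sum>j. real (Suc j) powr (- (2 * (\<alpha>' + p))))"
  have eb: "error_bound (\<alpha> + p) q (2 * (\<alpha>' + p)) s l N = bias l N + var N + (W l + V) / real N" for l N
    by (simp add: error_bound_def bias_def var_def W_def V_def)
  have le': "f l N \<le> ennreal (M * (bias l N + var N + (W l + V) / real N))" if "l \<in> Hs s" "N \<ge> 1" for l N
    using le[OF that] unfolding q_def[symmetric] eb .
  have inv: "(\<lambda>N. x / real N) \<in> O(\<rho> \<alpha> \<alpha>' p)" for x
  proof (rule landau_o.big_trans[OF bigoI inverse_in_bigo_rho[OF \<kappa>]])
    show "\<forall>\<^sub>F N in sequentially. norm (x / real N) \<le> \<bar>x\<bar> * norm (1 / real N)" by simp
  qed
  have cmult: "(\<lambda>N. x * g N) \<in> O(h)" if "g \<in> O(h)" for x :: real and g h :: "nat \<Rightarrow> real"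
    using that by (cases "x = 0") simp_all
  have var: "(\<lambda>N. var N) \<in> O(\<rho> \<alpha> \<alpha>' p)"
    unfolding var_def using variance_sum_bigo[OF \<kappa> b] .
  have w: "summable (\<lambda>j. real (Suc j) powr (2 * s) * \<bar>l j\<bar>\<^sup>2)" "\<And>j. 0 \<le> real (Suc j) powr (2 * s) * \<bar>l j\<bar>\<^sup>2"
    if "l \<in> Hs s" for l using that by (auto simp: Hs_def)
  have bias_le: "bias l N \<le> (1 / real N + real N powr (- q)) * W l" if "l \<in> Hs s" "N \<ge> 1" for l N
    unfolding bias_def W_def using bias_sum_le(2)[OF w[OF that(1)] q less_imp_le[OF \<kappa>] that(2)] .

  show "is_bigo_plus_smallo (f ldag) (\<rho> \<alpha> \<alpha>' p) (\<lambda>N. real N powr (- ((\<alpha>' + s) / (\<alpha> + p))))"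
    if l: "ldag \<in> Hs s"
  proof (cases "q < 1")
    case True
    show ?thesis unfolding q_def[symmetric]
    proof (rule is_bigo_plus_smalloI)
      show "\<forall>\<^sub>F N in sequentially. f ldag N \<le> ennreal (M * (var N + (W ldag + V) / real N) + M * bias ldag N)"
        using eventually_ge_at_top[of 1]
        by eventually_elim (use le'[OF l] in \<open>simp add: algebra_simps\<close>)
      show "(\<lambda>N. M * (var N + (W ldag + V) / real N)) \<in> O(\<rho> \<alpha> \<alpha>' p)"
        by (intro cmult sum_in_bigo var inv)
      have "bias ldag \<in> o(\<lambda>N. real N powr (- q))"
        unfolding bias_def[abs_def] using bias_sum_smallo[OF w[OF l] q True] .
      then show "(\<lambda>N. M * bias ldag N) \<in> o(\<lambda>N. real N powr (- q))"
        by (cases "M = 0") auto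
    qed
  next
    case False
    show ?thesis unfolding q_def[symmetric]
    proof (rule is_bigo_plus_smalloI)
      show "\<forall>\<^sub>F N in sequentially. f ldag N \<le> ennreal (M * (var N + (3 * W ldag + V) / real N) + 0)"
        using eventually_ge_at_top[of 1]
      proof eventually_elim
        case (elim N)
        have W: "0 \<le> W ldag" unfolding W_def using w[OF l] by (rule suminf_nonneg)
        have "real N powr (- q) \<le> real N powr (- 1)" using False elim by (intro powr_mono) auto
        also have "\<dots> = 1 / real N" using elim by (simp add: powr_minus field_simps)
        finally have "bias ldag N \<le> (1 / real N + 1 / real N) * W ldag"
          using bias_le[OF l elim] W by (meson add_left_mono mult_right_mono order_trans)
        moreover have "(3 * W ldag + V) / real N = (1 / real N + 1 / real N) * W ldag + (W ldag + V) / real N"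
          using elim by (simp add: field_simps)
        ultimately have "M * (bias ldag N + var N + (W ldag + V) / real N) \<le> M * (var N + (3 * W ldag + V) / real N)"
          using M by (intro mult_left_mono) auto
        then show ?case using le'[OF l elim] by (auto intro: order_trans ennreal_leI)
      qed
      show "(\<lambda>N. M * (var N + (3 * W ldag + V) / real N)) \<in> O(\<rho> \<alpha> \<alpha>' p)"
        by (intro cmult sum_in_bigo var inv)
    qed simp
  qed

  show "is_bigo (\<lambda>N. SUP l \<in> {l \<in> Hs s. Hs_norm s l \<le> R}. f l N)
             (\<lambda>N. \<rho> \<alpha> \<alpha>' p N + real N powr (- ((\<alpha>' + s) / (\<alpha> + p))))"
    unfolding q_def[symmetric]
  proof (rule is_bigoI)
    let ?a = "\<lambda>N. M * (R\<^sup>2 * (1 / real N + real N powr (- q)) + var N + (R\<^sup>2 + V) / real N)"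
    show "\<forall>\<^sub>F N in sequentially. (SUP l \<in> {l \<in> Hs s. Hs_norm s l \<le> R}. f l N) \<le> ennreal (?a N)"
      using eventually_ge_at_top[of 1]
    proof eventually_elim
      case (elim N)
      show ?case
      proof (rule SUP_least)
        fix l assume "l \<in> {l \<in> Hs s. Hs_norm s l \<le> R}"
        then have l: "l \<in> Hs s" and "sqrt (W l) \<le> R" by (auto simp: Hs_norm_def W_def)
        then have WR: "W l \<le> R\<^sup>2" using sqrt_le_D by blast
        have "bias l N \<le> (1 / real N + real N powr (- q)) * R\<^sup>2"
          using bias_le[OF l elim] WR by (rule order_trans[OF _ mult_left_mono]) auto
        then have "bias l N \<le> R\<^sup>2 * (1 / real N + real N powr (- q))" by (simp add: mult.commute)
        moreover have "(W l + V) / real N \<le> (R\<^sup>2 + V) / real N" using WR by (intro divide_right_mono) auto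
        ultimately have "M * (bias l N + var N + (W l + V) / real N) \<le> ?a N"
          using M by (intro mult_left_mono) auto
        then show "f l N \<le> ennreal (?a N)" using le'[OF l elim] by (auto intro: order_trans ennreal_leI)
      qed
    qed
    have "\<rho> \<alpha> \<alpha>' p \<in> O(\<lambda>N. \<rho> \<alpha> \<alpha>' p N + real N powr (- q))"
      "(\<lambda>N. real N powr (- q)) \<in> O(\<lambda>N. \<rho> \<alpha> \<alpha>' p N + real N powr (- q))"
      using rho_nonneg[of _ \<alpha> \<alpha>' p]
      by (auto intro!: bigoI[where c = 1] eventually_mono[OF eventually_ge_at_top[of 1]])
    note big = landau_o.big_trans[OF _ this(1)] this(2)
    show "?a \<in> O(\<lambda>N. \<rho> \<alpha> \<alpha>' p N + real N powr (- q))"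
      by (intro cmult sum_in_bigo big(1)[OF var] big(1)[OF inv] big(2))
  qed
qed

lemma training_snr_lower_bound:
  fixes \<sigma>2 v :: "nat \<Rightarrow> real"
  assumes "\<And>j. 0 < \<sigma>2 j" "\<And>j. 0 < v j" "0 < g"
    and "\<sigma>2 \<in> \<Omega>(\<lambda>j. real (Suc j) powr (- 2 * p))" "v \<in> \<Omega>(\<lambda>j. real (Suc j) powr (- 2 * \<alpha>))"
  obtains d where "0 < d" "\<And>j. d * real (Suc j) powr (- 2 * (\<alpha> + p)) \<le> g * \<sigma>2 j * v j"
proof -
  have "(\<lambda>j. real (Suc j) powr (- 2 * p)) \<in> O(\<sigma>2)" using assms(4) by (simp add: bigomega_iff_bigo)
  then obtain D1 where D1: "0 < D1" "\<And>j. \<bar>real (Suc j) powr (- 2 * p)\<bar> \<le> D1 * \<sigma>2 j"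
    using assms(1) bigo_imp_bounded_by by blast
  have "(\<lambda>j. real (Suc j) powr (- 2 * \<alpha>)) \<in> O(v)" using assms(5) by (simp add: bigomega_iff_bigo)
  then obtain D2 where D2: "0 < D2" "\<And>j. \<bar>real (Suc j) powr (- 2 * \<alpha>)\<bar> \<le> D2 * v j"
    using assms(2) bigo_imp_bounded_by by blast
  have "g / (D1 * D2) * real (Suc j) powr (- 2 * (\<alpha> + p)) \<le> g * \<sigma>2 j * v j" for j
  proof -
    have "real (Suc j) powr (- 2 * (\<alpha> + p)) = real (Suc j) powr (- 2 * p) * real (Suc j) powr (- 2 * \<alpha>)"
      by (subst powr_add[symmetric]) (simp add: algebra_simps)
    also have "\<dots> \<le> (D1 * \<sigma>2 j) * (D2 * v j)"
      using D1(2)[of j] D2(2)[of j] D1(1) assms(1)[of j] by (intro mult_mono) (auto simp: less_imp_le)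
    finally have "g * real (Suc j) powr (- 2 * (\<alpha> + p)) \<le> g * ((D1 * \<sigma>2 j) * (D2 * v j))"
      using assms(3) by (intro mult_left_mono) auto
    then show ?thesis using D1(1) D2(1) by (simp add: divide_le_eq mult_ac)
  qed
  then show ?thesis using D1(1) D2(1) assms(3) by (intro that[of "g / (D1 * D2)"]) auto
qed

lemma inverse_one_add_le_shrink:
  assumes "0 < d" "d * real (Suc j) powr (- 2 * \<kappa>) \<le> a"
  shows "1 / (1 + a * real N) \<le> (1 + 1 / d) * shrink \<kappa> N j"
proof -
  define x where "x = real N * real (Suc j) powr (- 2 * \<kappa>)"
  have x: "0 \<le> x" by (simp add: x_def)
  have "d * x \<le> a * real N"
    using mult_right_mono[OF assms(2), of "real N"] by (simp add: x_def mult_ac)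
  then have "1 / (1 + a * real N) \<le> 1 / (1 + d * x)"
    using x assms(1) by (intro divide_left_mono mult_pos_pos add_pos_nonneg) (auto intro: order_trans[of _ "d * x"])
  also have "\<dots> \<le> (1 + 1 / d) / (1 + x)"
  proof -
    have "1 + x \<le> (1 + 1 / d) * (1 + d * x)" using assms(1) x by (simp add: field_simps)
    then show ?thesis using x assms(1) by (simp add: divide_le_eq le_divide_eq add_pos_nonneg mult_ac)
  qed
  finally show ?thesis by (simp add: shrink_def x_def)
qed

text \<open>The asymptotic assumptions on the prior and on both covariances become inequalities with
  constants for all \<open>j\<close>, and the constants are collected in \<open>M\<close>, which does not depend on the truth.\<close>

lemma test_errors_le_error_bound:
  fixes \<phi> :: "nat \<Rightarrow> 'h::{real_inner,banach,second_countable_topology}"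
  assumes \<phi>: "orthonormal_basis \<phi>" and \<gamma>: "\<gamma> > 0"
    and tr: "training_distribution \<nu> \<Lambda>" and test: "test_distribution \<phi> \<nu>' \<Lambda>'"
    and \<sigma>: "\<And>j. (\<sigma> j)\<^sup>2 > 0"
    and \<kappa>: "0 < \<alpha> + p" and b: "1/2 < \<alpha>' + p" and r: "0 < \<alpha>' + s"
    and \<Theta>: "(\<lambda>j. (\<sigma> j)\<^sup>2) \<in> \<Theta>(\<lambda>j. real (Suc j) powr (- 2 * p))"
      "(\<lambda>j. inner (\<phi> j) (\<Lambda> (\<phi> j))) \<in> \<Omega>(\<lambda>j. real (Suc j) powr (- 2 * \<alpha>))"
      "(\<lambda>j. inner (\<phi> j) (\<Lambda>' (\<phi> j))) \<in> O(\<lambda>j. real (Suc j) powr (- 2 * \<alpha>'))"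
    and mom: "moment_assumption \<phi> \<nu> \<Lambda>"
  obtains M where "0 \<le> M"
    "\<And>l N. l \<in> Hs s \<Longrightarrow> N \<ge> 1 \<Longrightarrow> posterior_test_error \<phi> \<gamma> \<sigma> \<nu> \<nu>' l N
        \<le> ennreal (M * error_bound (\<alpha> + p) ((\<alpha>' + s) / (\<alpha> + p)) (2 * (\<alpha>' + p)) s l N)"
    "\<And>l N. l \<in> Hs s \<Longrightarrow> N \<ge> 1 \<Longrightarrow> mean_test_error \<phi> \<gamma> \<sigma> \<nu> \<nu>' l N
        \<le> ennreal (M * error_bound (\<alpha> + p) ((\<alpha>' + s) / (\<alpha> + p)) (2 * (\<alpha>' + p)) s l N)"
proof -
  define q where "q = (\<alpha>' + s) / (\<alpha> + p)"
  have q: "0 < q" using \<kappa> r by (simp add: q_def)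
  define v where "v j = inner (\<phi> j) (\<Lambda> (\<phi> j))" for j
  define \<theta> where "\<theta> j = inner (\<phi> j) (\<Lambda>' (\<phi> j))" for j
  have "inner (\<phi> j) (\<phi> j) = 1" for j using \<phi> by (simp add: orthonormal_basis_def)
  then have nz: "\<phi> j \<noteq> 0" for j by (metis inner_zero_left zero_neq_one)
  have v: "0 < v j" for j using tr nz by (simp add: training_distribution_def v_def)
  have \<theta>: "0 \<le> \<theta> j" for j unfolding \<theta>_def by (rule test_variance_nonneg[OF test])
  obtain C1 where C1: "0 < C1" "\<And>j. \<bar>\<theta> j\<bar> \<le> C1 * real (Suc j) powr (- 2 * \<alpha>')"
    using bigo_imp_bounded_by[OF \<Theta>(3)] unfolding \<theta>_def by auto
  obtain C2 where C2: "0 < C2" "\<And>j. \<bar>(\<sigma> j)\<^sup>2\<bar> \<le> C2 * real (Suc j) powr (- 2 * p)"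
    using bigo_imp_bounded_by[OF bigthetaD1[OF \<Theta>(1)]] by auto
  have "0 < \<gamma> powi (-2) / 2" using \<gamma> by simp
  from training_snr_lower_bound[OF \<sigma> v this bigthetaD2[OF \<Theta>(1)] \<Theta>(2)[folded v_def]]
  obtain d where d: "0 < d" "\<And>j. d * real (Suc j) powr (- 2 * (\<alpha> + p)) \<le> \<gamma> powi (-2) / 2 * (\<sigma> j)\<^sup>2 * v j"
    by blast
  obtain c where c: "0 < c" "\<And>\<gamma> \<sigma> N j. (\<integral>\<^sup>+ X. ennreal (1 / (1 + snr \<phi> \<gamma> \<sigma> N j X)) \<partial>(\<Pi>\<^sub>M n\<in>{..<N}. \<nu>))
    \<le> ennreal (1 / (1 + \<gamma> powi (-2) * (\<sigma> j)\<^sup>2 * v j * (real N / 2)) + exp (- c * real N))"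
    using expected_shrinkage_le[OF tr mom nz] unfolding v_def by metis
  define M1 where "M1 = C1 * (1 + 2 * C2)"
  define M2 where "M2 = 1 + 1 / d + 1 / c"
  have M: "0 \<le> M1" "0 \<le> M2" using C1(1) C2(1) c(1) d(1) by (simp_all add: M1_def M2_def)
  have main: "(\<Sum>j. ennreal (\<theta> j * ((l j)\<^sup>2 + 2 * (\<sigma> j)\<^sup>2)) *
        (\<integral>\<^sup>+ X. ennreal (1 / (1 + snr \<phi> \<gamma> \<sigma> N j X)) \<partial>(\<Pi>\<^sub>M n\<in>{..<N}. \<nu>)))
      \<le> ennreal (M1 * M2 * error_bound (\<alpha> + p) q (2 * (\<alpha>' + p)) s l N)"
    if l: "l \<in> Hs s" and N: "N \<ge> 1" for l N
  proof -
    define S where "S j = 1 / (1 + \<gamma> powi (-2) * (\<sigma> j)\<^sup>2 * v j * (real N / 2)) + exp (- c * real N)" for j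
    define T where "T j = \<theta> j * ((l j)\<^sup>2 + 2 * (\<sigma> j)\<^sup>2) * S j" for j
    have S0: "0 \<le> S j" for j
      unfolding S_def using v[of j] by (intro add_nonneg_nonneg divide_nonneg_nonneg mult_nonneg_nonneg)
        (auto simp: power_int_def less_imp_le)
    have S: "S j \<le> M2 * (shrink (\<alpha> + p) N j + 1 / real N)" for j
    proof -
      have "1 / (1 + \<gamma> powi (-2) / 2 * (\<sigma> j)\<^sup>2 * v j * real N) \<le> (1 + 1 / d) * shrink (\<alpha> + p) N j"
        by (rule inverse_one_add_le_shrink[OF d])
      moreover have "exp (- c * real N) \<le> 1 / c * (1 / real N)"
      proof -
        have cN: "0 < c * real N" using c(1) N by simp
        have "c * real N \<le> exp (c * real N)" using exp_ge_add_one_self[of "c * real N"] by linarith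
        then have "1 / exp (c * real N) \<le> 1 / (c * real N)" using cN by (intro divide_left_mono) auto
        then show ?thesis by (simp add: exp_minus field_simps)
      qed
      ultimately have "S j \<le> (1 + 1 / d) * shrink (\<alpha> + p) N j + 1 / c * (1 / real N)"
        by (simp add: S_def mult_ac)
      also have "\<dots> \<le> M2 * shrink (\<alpha> + p) N j + M2 * (1 / real N)"
      proof -
        have "1 + 1 / d \<le> M2" "1 / c \<le> M2" using c(1) d(1) by (simp_all add: M2_def)
        then show ?thesis
          using shrink_bounds(1)[of "\<alpha> + p" N j] by (intro add_mono mult_right_mono) auto
      qed
      finally show ?thesis by (simp add: distrib_left)
    qed
    have P: "\<theta> j * ((l j)\<^sup>2 + 2 * (\<sigma> j)\<^sup>2) \<le> M1 * (real (Suc j) powr (2 * s) * \<bar>l j\<bar>\<^sup>2 *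
        real (Suc j) powr (- 2 * (\<alpha> + p) * q) + real (Suc j) powr (- (2 * (\<alpha>' + p))))" for j
    proof -
      have "real (Suc j) powr (2 * s) * real (Suc j) powr (- 2 * (\<alpha> + p) * q) = real (Suc j) powr (- 2 * \<alpha>')"
      proof -
        have "(\<alpha> + p) * q = \<alpha>' + s" using \<kappa> by (simp add: q_def)
        then have "2 * s + - 2 * (\<alpha> + p) * q = - 2 * \<alpha>'" by (simp only: mult.assoc) simp
        then show ?thesis by (subst powr_add[symmetric]) simp
      qed
      then have e1: "real (Suc j) powr (2 * s) * \<bar>l j\<bar>\<^sup>2 * real (Suc j) powr (- 2 * (\<alpha> + p) * q)
          = real (Suc j) powr (- 2 * \<alpha>') * (l j)\<^sup>2"
        by (simp add: mult_ac)
      have e2: "real (Suc j) powr (- (2 * (\<alpha>' + p))) = real (Suc j) powr (- 2 * \<alpha>') * real (Suc j) powr (- 2 * p)"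
        by (subst powr_add[symmetric]) (simp add: algebra_simps)
      have "(l j)\<^sup>2 + 2 * (\<sigma> j)\<^sup>2 \<le> (l j)\<^sup>2 + 2 * (C2 * real (Suc j) powr (- 2 * p))"
        using C2(2)[of j] by simp
      also have "\<dots> \<le> (1 + 2 * C2) * ((l j)\<^sup>2 + real (Suc j) powr (- 2 * p))"
        using C2(1) by (simp add: algebra_simps)
      finally have "\<theta> j * ((l j)\<^sup>2 + 2 * (\<sigma> j)\<^sup>2) \<le> (C1 * real (Suc j) powr (- 2 * \<alpha>')) *
          ((1 + 2 * C2) * ((l j)\<^sup>2 + real (Suc j) powr (- 2 * p)))"
        using C1 \<theta>[of j] by (intro mult_mono) (auto intro: order_trans[OF abs_ge_self])
      then show ?thesis unfolding e1 e2 M1_def by (simp add: algebra_simps)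
    qed
    have "(\<Sum>j. ennreal (\<theta> j * ((l j)\<^sup>2 + 2 * (\<sigma> j)\<^sup>2)) *
        (\<integral>\<^sup>+ X. ennreal (1 / (1 + snr \<phi> \<gamma> \<sigma> N j X)) \<partial>(\<Pi>\<^sub>M n\<in>{..<N}. \<nu>)))
      \<le> (\<Sum>j. ennreal (T j))"
    proof (rule suminf_le)
      fix j
      have "ennreal (T j) = ennreal (\<theta> j * ((l j)\<^sup>2 + 2 * (\<sigma> j)\<^sup>2)) * ennreal (S j)"
        unfolding T_def using \<theta>[of j] S0[of j] by (intro ennreal_mult) auto
      then show "ennreal (\<theta> j * ((l j)\<^sup>2 + 2 * (\<sigma> j)\<^sup>2)) *
        (\<integral>\<^sup>+ X. ennreal (1 / (1 + snr \<phi> \<gamma> \<sigma> N j X)) \<partial>(\<Pi>\<^sub>M n\<in>{..<N}. \<nu>)) \<le> ennreal (T j)"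
        using c(2)[where \<gamma> = \<gamma> and \<sigma> = \<sigma>] by (simp add: S_def mult_left_mono)
    qed auto
    also have "\<dots> \<le> ennreal (M1 * M2 * error_bound (\<alpha> + p) q (2 * (\<alpha>' + p)) s l N)"
    proof (rule series_le_error_bound[OF l N _ q])
      show "0 \<le> T j" for j unfolding T_def using \<theta>[of j] S0[of j] by simp
      show "T j \<le> M1 * M2 * (real (Suc j) powr (2 * s) * \<bar>l j\<bar>\<^sup>2 * real (Suc j) powr (- 2 * (\<alpha> + p) * q)
        + real (Suc j) powr (- (2 * (\<alpha>' + p)))) * (shrink (\<alpha> + p) N j + 1 / real N)" for j
        using mult_mono[OF P[of j] S[of j] _ S0[of j]] M \<theta>[of j] unfolding T_def
        by (simp add: mult_ac)
    qed (use \<kappa> b M in auto)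
    finally show ?thesis .
  qed
  have prob: "prob_space \<nu>" "sets \<nu> = sets borel" using tr by (auto simp: training_distribution_def)
  show ?thesis
  proof (rule that[of "M1 * M2"])
    show "0 \<le> M1 * M2" using M by simp
    fix l N assume lN: "l \<in> Hs s" "(N::nat) \<ge> 1"
    note le = test_errors_le[OF \<phi> prob test \<sigma> lN(2) \<gamma>, where l = l, folded \<theta>_def]
    show "posterior_test_error \<phi> \<gamma> \<sigma> \<nu> \<nu>' l N
        \<le> ennreal (M1 * M2 * error_bound (\<alpha> + p) ((\<alpha>' + s) / (\<alpha> + p)) (2 * (\<alpha>' + p)) s l N)"
      using order_trans[OF le(1) main[OF lN]] unfolding q_def .
    show "mean_test_error \<phi> \<gamma> \<sigma> \<nu> \<nu>' l N
        \<le> ennreal (M1 * M2 * error_bound (\<alpha> + p) ((\<alpha>' + s) / (\<alpha> + p)) (2 * (\<alpha>' + p)) s l N)"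
      using order_trans[OF le(2) main[OF lN]] unfolding q_def .
  qed
qed

theorem theorem3p3:
  fixes \<phi> :: "nat \<Rightarrow> 'h::{real_inner,banach,second_countable_topology}"
    and \<nu> :: "'h measure" and \<Lambda> :: "'h \<Rightarrow> 'h"
    and \<nu>' :: "(nat \<Rightarrow> real) measure" and \<Lambda>' :: "'h \<Rightarrow> 'h"
    and \<sigma> ldag :: "nat \<Rightarrow> real"
    and \<gamma> s p \<alpha> \<alpha>' :: real
  assumes "orthonormal_basis \<phi>"
    and "\<gamma> > 0"
    and "training_distribution \<nu> \<Lambda>"
    and "test_distribution \<phi> \<nu>' \<Lambda>'"
    and "\<And>j. (\<sigma> j)\<^sup>2 > 0"
    and "\<alpha> > 1/2" and "\<alpha>' \<ge> 0"
    and "min \<alpha> \<alpha>' + s > 0" and "min \<alpha> \<alpha>' + (p - 1/2) > 0"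
    and "ldag \<in> Hs s"
    and "(\<lambda>j. (\<sigma> j)\<^sup>2) \<in> \<Theta>(\<lambda>j. real (Suc j) powr (- 2 * p))"
    and "(\<lambda>j. inner (\<phi> j) (\<Lambda> (\<phi> j))) \<in> \<Theta>(\<lambda>j. real (Suc j) powr (- 2 * \<alpha>))"
    and "(\<lambda>j. inner (\<phi> j) (\<Lambda>' (\<phi> j))) \<in> \<Theta>(\<lambda>j. real (Suc j) powr (- 2 * \<alpha>'))"
    and "moment_assumption \<phi> \<nu> \<Lambda>"
  shows "is_bigo_plus_smallo (posterior_test_error \<phi> \<gamma> \<sigma> \<nu> \<nu>' ldag)
             (\<rho> \<alpha> \<alpha>' p) (\<lambda>N. real N powr (- ((\<alpha>' + s) / (\<alpha> + p))))
       \<and> (\<forall>R>0. is_bigo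
             (\<lambda>N. SUP l \<in> {l \<in> Hs s. Hs_norm s l \<le> R}. posterior_test_error \<phi> \<gamma> \<sigma> \<nu> \<nu>' l N)
             (\<lambda>N. \<rho> \<alpha> \<alpha>' p N + real N powr (- ((\<alpha>' + s) / (\<alpha> + p)))))
       \<and> is_bigo_plus_smallo (mean_test_error \<phi> \<gamma> \<sigma> \<nu> \<nu>' ldag)
             (\<rho> \<alpha> \<alpha>' p) (\<lambda>N. real N powr (- ((\<alpha>' + s) / (\<alpha> + p))))
       \<and> (\<forall>R>0. is_bigo
             (\<lambda>N. SUP l \<in> {l \<in> Hs s. Hs_norm s l \<le> R}. mean_test_error \<phi> \<gamma> \<sigma> \<nu> \<nu>' l N)
             (\<lambda>N. \<rho> \<alpha> \<alpha>' p N + real N powr (- ((\<alpha>' + s) / (\<alpha> + p)))))"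
proof -
  have \<kappa>: "0 < \<alpha> + p" and b: "1/2 < \<alpha>' + p" and r: "0 < \<alpha>' + s"
    using assms(8,9) by (auto simp: min_def split: if_splits)
  obtain M where M: "0 \<le> M"
    "\<And>l N. l \<in> Hs s \<Longrightarrow> N \<ge> 1 \<Longrightarrow> posterior_test_error \<phi> \<gamma> \<sigma> \<nu> \<nu>' l N
        \<le> ennreal (M * error_bound (\<alpha> + p) ((\<alpha>' + s) / (\<alpha> + p)) (2 * (\<alpha>' + p)) s l N)"
    "\<And>l N. l \<in> Hs s \<Longrightarrow> N \<ge> 1 \<Longrightarrow> mean_test_error \<phi> \<gamma> \<sigma> \<nu> \<nu>' l N
        \<le> ennreal (M * error_bound (\<alpha> + p) ((\<alpha>' + s) / (\<alpha> + p)) (2 * (\<alpha>' + p)) s l N)"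
    using test_errors_le_error_bound[OF assms(1-5) \<kappa> b r assms(11) bigthetaD2[OF assms(12)]
        bigthetaD1[OF assms(13)] assms(14)] by blast
  show ?thesis
    using rates_of_error_bound[where f = "posterior_test_error \<phi> \<gamma> \<sigma> \<nu> \<nu>'", OF \<kappa> b r M(1) M(2)]
      rates_of_error_bound[where f = "mean_test_error \<phi> \<gamma> \<sigma> \<nu> \<nu>'", OF \<kappa> b r M(1) M(3)]
      assms(10)
    by blast
qed

end
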